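(* Let $\Bbbk$ be a field, let $\mathbf{P}=[p]\times[q]$ be a 2D-grid ($p,q$ positive integers), let $\operatorname{tot}$ be the total compression system and $\operatorname{zz}=(\operatorname{zz}_I\colon I^{\operatorname{zz}}\hookrightarrow\mathbf{P})_{I\in\mathbb{I}}$ the zigzag compression system defined in the context. Then the interval rank invariants under $\operatorname{zz}$ and $\operatorname{tot}$ coincide: $\operatorname{rank}^{\operatorname{tot}}_{\mathbb{I}}=\operatorname{rank}^{\operatorname{zz}}_{\mathbb{I}}$, i.e. for every $M\in\operatorname{mod}\Bbbk[\mathbf{P}]$ and every interval $I$ of $\mathbf{P}$, $\operatorname{rank}^{\operatorname{tot}}_IM=\operatorname{rank}^{\operatorname{zz}}_IM$.
   Context: $[p]=\{1<2<\dots<p\}$, and $[p]\times[q]$ has the product order. For a poset $S$, $\Bbbk[S]$ is the $\Bbbk$-linear category with object set $S$, $\Bbbk[S](x,y)=\Bbbk p_{y,x}$ (one-dimensional) if $x\le y$ and $0$ otherwise, $p_{z,y}p_{y,x}=p_{z,x}$, identities $p_{x,x}$. An order-preserving map $f$ induces a linear functor $\Bbbk[f]$ by $x\mapsto f(x)$, $p_{y,x}\mapsto p_{f(y),f(x)}$. $\operatorname{mod}\Bbbk[S]$ is the category of $\Bbbk$-linear functors $\Bbbk[S]\to\operatorname{mod}\Bbbk$ (finite-dimensional vector spaces). A nonempty full subposet $I\subseteq\mathbf{P}$ is an interval if it is connected (any two elements are joined by a finite sequence in $I$ whose consecutive elements are comparable) and convex. $\mathbb{I}$ is the set of all intervals;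 $\operatorname{sc}(I)$, $\operatorname{sk}(I)$ are the sets of minimal and maximal elements. The interval module $V_I$ has $V_I(x)=\Bbbk$ for $x\in I$, $0$ otherwise, and $V_I(p_{y,x})=\mathrm{id}_\Bbbk$ if $x\le y$ are both in $I$, $0$ otherwise. A compression system is a family $\xi$ of order-preserving maps $\xi_I\colon I^\xi\to\mathbf{P}$ ($I\in\mathbb{I}$) from connected (nonempty) finite posets $I^\xi$ such that for all $I$: (1) the image of $\xi_I$ is contained in $I$; (2) it contains $\operatorname{sc}(I)\cup\operatorname{sk}(I)$. It is a rank compression system if moreover (3) whenever $I=[x,y]=\{z\mid x\le z\le y\}$ with $x\le y$, there are $x'\le y'$ in $I^\xi$ with $\xi_I(x')=x$, $\xi_I(y')=y$. Put $R^\xi_I(M)=M\circ\Bbbk[\xi_I]$. The module $R^\xi_I(V_I)$ is indecomposable, and for a rank compression system $\xi$, $\operatorname{rank}^\xi_IM$ is the multiplicity of $R^\xi_I(V_I)$ as a direct summand in the indecomposable decomposition of $R^\xi_I(M)$; $\operatorname{rank}^\xi_{\mathbb{I}}M=(\operatorname{rank}^\xi_IM)_{I\in\mathbb{I}}$. $\operatorname{tot}$: $I^{\operatorname{tot}}=I$ and $\operatorname{tot}_I$ is the inclusion $I\hookrightarrow\mathbf{P}$. $\operatorname{zz}$: for $I\in\mathbb{I}$ write $\operatorname{sc}(I)=\{a_1,\dots,a_n\}$ and $\operatorname{sk}(I)=\{b_1,\dots,b_m\}$, numbered so that the first coordinates of $a_1,\dots,a_n$ (resp. $b_1,\dots,b_m$)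 are strictly increasing. Let $a_{i,i+1}=a_i\vee a_{i+1}$ ($i\in[n-1]$) and $b_{j,j+1}=b_j\wedge b_{j+1}$ ($j\in[m-1]$) be the join and meet in $I$. Then $I^{\operatorname{zz}}$ is the (not necessarily full) subposet of $I$ with underlying set $\operatorname{sc}(I)\cup\{a_{i,i+1}\mid i\in[n-1]\}\cup\operatorname{sk}(I)\cup\{b_{j,j+1}\mid j\in[m-1]\}$ and with the partial order generated by the relations $a_i\le a_{i,i+1}$, $a_{i+1}\le a_{i,i+1}$ ($i\in[n-1]$), $b_{j,j+1}\le b_j$, $b_{j,j+1}\le b_{j+1}$ ($j\in[m-1]$) and $a_1\le b_1$. The map $\operatorname{zz}_I$ is the inclusion. Both $\operatorname{tot}$ and $\operatorname{zz}$ are rank compression systems. *)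

theory Defs
  imports Complex_Main "HOL-Library.FuncSet"
begin

section \<open>Posets\<close>

text \<open>A poset is a relation \<open>r\<close> with \<^prop>\<open>Partial_order r\<close>; its underlying set is
  \<^term>\<open>Field r\<close>, and \<open>(x, y) \<in> r\<close> means \<open>x \<le> y\<close>. The full subposet on
  \<open>I \<subseteq> Field r\<close> is \<^term>\<open>Restr r I\<close>.\<close>

definition connected_poset :: "'a rel \<Rightarrow> bool" where
  "connected_poset r \<longleftrightarrow> r \<noteq> {} \<and> (\<forall>x\<in>Field r. \<forall>y\<in>Field r. (x, y) \<in> (r \<union> r\<inverse>)\<^sup>*)"

definition convex_in :: "'a rel \<Rightarrow> 'a set \<Rightarrow> bool" where
  "convex_in r I \<longleftrightarrow> (\<forall>x\<in>I. \<forall>y\<in>I. \<forall>z. (x, z) \<in> r \<longrightarrow> (z, y) \<in> r \<longrightarrow> z \<in> I)"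

definition interval :: "'a rel \<Rightarrow> 'a set \<Rightarrow> bool" where
  "interval r I \<longleftrightarrow> I \<noteq> {} \<and> I \<subseteq> Field r \<and> connected_poset (Restr r I) \<and> convex_in r I"

definition sc :: "'a rel \<Rightarrow> 'a set \<Rightarrow> 'a set" where
  "sc r I = {x \<in> I. \<forall>y\<in>I. (y, x) \<in> r \<longrightarrow> y = x}"

definition sk :: "'a rel \<Rightarrow> 'a set \<Rightarrow> 'a set" where
  "sk r I = {x \<in> I. \<forall>y\<in>I. (x, y) \<in> r \<longrightarrow> y = x}"

definition poset_join :: "'a rel \<Rightarrow> 'a \<Rightarrow> 'a \<Rightarrow> 'a" where
  "poset_join r x y =
    (THE z. (x, z) \<in> r \<and> (y, z) \<in> r \<and> (\<forall>w. (x, w) \<in> r \<longrightarrow> (y, w) \<in> r \<longrightarrow> (z, w) \<in> r))"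

definition poset_meet :: "'a rel \<Rightarrow> 'a \<Rightarrow> 'a \<Rightarrow> 'a" where
  "poset_meet r x y =
    (THE z. (z, x) \<in> r \<and> (z, y) \<in> r \<and> (\<forall>w. (w, x) \<in> r \<longrightarrow> (w, y) \<in> r \<longrightarrow> (w, z) \<in> r))"

definition grid :: "nat \<Rightarrow> nat \<Rightarrow> (nat \<times> nat) rel" where
  "grid p q = relation_of (\<lambda>x y. fst x \<le> fst y \<and> snd x \<le> snd y) ({1..p} \<times> {1..q})"


section \<open>Modules over the incidence category of a poset\<close>

text \<open>A \<open>\<kk>\<close>-linear functor \<open>M\<close> on \<open>\<kk>[S]\<close> is determined by the vector spaces
  \<open>M(x)\<close> and the maps \<open>M(p\<^sub>y\<^sub>,\<^sub>x)\<close> for \<open>x \<le> y\<close>, because every morphism space is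
  either zero or spanned by \<open>p\<^sub>y\<^sub>,\<^sub>x\<close>. Here \<^term>\<open>vspace M x\<close> is \<open>M(x)\<close>, a
  finite-dimensional subspace of an ambient \<open>\<kk>\<close>-vector space with scalar
  multiplication \<open>s\<close>, and \<^term>\<open>act M y x\<close> is \<open>M(p\<^sub>y\<^sub>,\<^sub>x)\<close>. The common ambient space
  is no restriction, since finitely many spaces embed in their direct sum; it need not
  be finite-dimensional. Values of \<open>vspace M\<close> and \<open>act M\<close> outside the poset, at
  incomparable pairs, or at vectors outside \<open>M(x)\<close> are irrelevant.\<close>

record ('a, 'v) rep =
  vspace :: "'a \<Rightarrow> 'v set"
  act :: "'a \<Rightarrow> 'a \<Rightarrow> 'v \<Rightarrow> 'v"

definition fin_dim_subspace :: "('k::field \<Rightarrow> 'v::ab_group_add \<Rightarrow> 'v) \<Rightarrow> 'v set \<Rightarrow> bool" where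
  "fin_dim_subspace s V \<longleftrightarrow> module.subspace s V \<and> (\<exists>B. finite B \<and> module.span s B = V)"

definition linear_between ::
  "('k::field \<Rightarrow> 'v::ab_group_add \<Rightarrow> 'v) \<Rightarrow> ('k \<Rightarrow> 'w::ab_group_add \<Rightarrow> 'w) \<Rightarrow>
   'v set \<Rightarrow> 'w set \<Rightarrow> ('v \<Rightarrow> 'w) \<Rightarrow> bool" where
  "linear_between s t V W f \<longleftrightarrow> f \<in> V \<rightarrow> W \<and>
    (\<forall>u\<in>V. \<forall>v\<in>V. f (u + v) = f u + f v) \<and> (\<forall>c. \<forall>v\<in>V. f (s c v) = t c (f v))"

definition is_rep ::
  "('k::field \<Rightarrow> 'v::ab_group_add \<Rightarrow> 'v) \<Rightarrow> 'a rel \<Rightarrow> ('a, 'v) rep \<Rightarrow> bool" where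
  "is_rep s S M \<longleftrightarrow>
    (\<forall>x\<in>Field S. fin_dim_subspace s (vspace M x)) \<and>
    (\<forall>x y. (x, y) \<in> S \<longrightarrow> linear_between s s (vspace M x) (vspace M y) (act M y x)) \<and>
    (\<forall>x\<in>Field S. \<forall>v\<in>vspace M x. act M x x v = v) \<and>
    (\<forall>x y z. (x, y) \<in> S \<longrightarrow> (y, z) \<in> S \<longrightarrow>
      (\<forall>v\<in>vspace M x. act M z y (act M y x v) = act M z x v))"

definition rep_iso ::
  "'a rel \<Rightarrow> ('k::field \<Rightarrow> 'v::ab_group_add \<Rightarrow> 'v) \<Rightarrow> ('a, 'v) rep \<Rightarrow>
   ('k \<Rightarrow> 'w::ab_group_add \<Rightarrow> 'w) \<Rightarrow> ('a, 'w) rep \<Rightarrow> bool" where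
  "rep_iso S s M t N \<longleftrightarrow> (\<exists>\<phi>.
    (\<forall>x\<in>Field S. linear_between s t (vspace M x) (vspace N x) (\<phi> x) \<and>
      bij_betw (\<phi> x) (vspace M x) (vspace N x)) \<and>
    (\<forall>x y. (x, y) \<in> S \<longrightarrow> (\<forall>v\<in>vspace M x. \<phi> y (act M y x v) = act N y x (\<phi> x v))))"

definition zero_rep :: "'a rel \<Rightarrow> ('a, 'v::zero) rep \<Rightarrow> bool" where
  "zero_rep S M \<longleftrightarrow> (\<forall>x\<in>Field S. vspace M x = {0})"

text \<open>\<open>M = U\<^sub>0 \<oplus> \<dots> \<oplus> U\<^sub>n\<^sub>-\<^sub>1\<close> as an internal direct sum, where the submodule
  \<open>U\<^sub>i\<close> has the spaces \<^term>\<open>U i x\<close> and the structure maps of \<open>M\<close>.\<close>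

definition direct_sum_decomp ::
  "('k::field \<Rightarrow> 'v::ab_group_add \<Rightarrow> 'v) \<Rightarrow> 'a rel \<Rightarrow> ('a, 'v) rep \<Rightarrow> nat \<Rightarrow>
   (nat \<Rightarrow> 'a \<Rightarrow> 'v set) \<Rightarrow> bool" where
  "direct_sum_decomp s S M n U \<longleftrightarrow>
    (\<forall>i<n. is_rep s S (M\<lparr>vspace := U i\<rparr>) \<and> (\<forall>x\<in>Field S. U i x \<subseteq> vspace M x)) \<and>
    (\<forall>x\<in>Field S. \<forall>v\<in>vspace M x. \<exists>!c. c \<in> (\<Pi>\<^sub>E i\<in>{..<n}. U i x) \<and> v = (\<Sum>i<n. c i))"

definition indecomposable ::
  "('k::field \<Rightarrow> 'v::ab_group_add \<Rightarrow> 'v) \<Rightarrow> 'a rel \<Rightarrow> ('a, 'v) rep \<Rightarrow> bool" where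
  "indecomposable s S M \<longleftrightarrow> \<not> zero_rep S M \<and>
    (\<forall>U. direct_sum_decomp s S M 2 U \<longrightarrow>
      zero_rep S (M\<lparr>vspace := U 0\<rparr>) \<or> zero_rep S (M\<lparr>vspace := U 1\<rparr>))"

definition indec_decomp ::
  "('k::field \<Rightarrow> 'v::ab_group_add \<Rightarrow> 'v) \<Rightarrow> 'a rel \<Rightarrow> ('a, 'v) rep \<Rightarrow> nat \<Rightarrow>
   (nat \<Rightarrow> 'a \<Rightarrow> 'v set) \<Rightarrow> bool" where
  "indec_decomp s S M n U \<longleftrightarrow> direct_sum_decomp s S M n U \<and>
    (\<forall>i<n. indecomposable s S (M\<lparr>vspace := U i\<rparr>))"

text \<open>The number of summands isomorphic to \<open>X\<close> in an indecomposable decomposition of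
  \<open>M\<close>; by the Krull-Schmidt theorem it exists and does not depend on the decomposition.\<close>

definition multiplicity_in ::
  "'a rel \<Rightarrow> ('k::field \<Rightarrow> 'w::ab_group_add \<Rightarrow> 'w) \<Rightarrow> ('a, 'w) rep \<Rightarrow>
   ('k \<Rightarrow> 'v::ab_group_add \<Rightarrow> 'v) \<Rightarrow> ('a, 'v) rep \<Rightarrow> nat" where
  "multiplicity_in S t X s M = (THE m. \<exists>n U. indec_decomp s S M n U \<and>
    m = card {i. i < n \<and> rep_iso S s (M\<lparr>vspace := U i\<rparr>) t X})"

definition interval_module :: "'a set \<Rightarrow> ('a, 'k::field) rep" where
  "interval_module I =
    \<lparr>vspace = (\<lambda>x. if x \<in> I then UNIV else {0}),
     act = (\<lambda>y x v. if x \<in> I \<and> y \<in> I then v else 0)\<rparr>"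


section \<open>Compression systems and interval ranks\<close>

text \<open>A family \<open>\<xi>\<close> sends \<open>I\<close> to the pair consisting of the poset \<open>I\<^sup>\<xi>\<close> and the map
  \<open>\<xi>\<^sub>I\<close>.\<close>

type_synonym ('a, 'b) compression = "'a set \<Rightarrow> 'b rel \<times> ('b \<Rightarrow> 'a)"

definition compression_system :: "'a rel \<Rightarrow> ('a, 'b) compression \<Rightarrow> bool" where
  "compression_system P \<xi> \<longleftrightarrow> (\<forall>I. interval P I \<longrightarrow> (case \<xi> I of (Q, f) \<Rightarrow>
    Partial_order Q \<and> finite (Field Q) \<and> connected_poset Q \<and>
    (\<forall>x y. (x, y) \<in> Q \<longrightarrow> (f x, f y) \<in> P) \<and>
    f ` Field Q \<subseteq> I \<and> sc P I \<union> sk P I \<subseteq> f ` Field Q))"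

definition rank_compression_system :: "'a rel \<Rightarrow> ('a, 'b) compression \<Rightarrow> bool" where
  "rank_compression_system P \<xi> \<longleftrightarrow> compression_system P \<xi> \<and>
    (\<forall>x y. (x, y) \<in> P \<longrightarrow> (case \<xi> {z. (x, z) \<in> P \<and> (z, y) \<in> P} of (Q, f) \<Rightarrow>
      \<exists>x' y'. (x', y') \<in> Q \<and> f x' = x \<and> f y' = y))"

definition pullback_rep :: "('b \<Rightarrow> 'a) \<Rightarrow> ('a, 'v) rep \<Rightarrow> ('b, 'v) rep" where
  "pullback_rep f M =
    \<lparr>vspace = (\<lambda>x. vspace M (f x)), act = (\<lambda>y x. act M (f y) (f x))\<rparr>"

definition interval_rank ::
  "('k::field \<Rightarrow> 'v::ab_group_add \<Rightarrow> 'v) \<Rightarrow> ('a, 'b) compression \<Rightarrow> 'a set \<Rightarrow>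
   ('a, 'v) rep \<Rightarrow> nat" where
  "interval_rank s \<xi> I M = (case \<xi> I of (Q, f) \<Rightarrow>
    multiplicity_in Q ((*) :: 'k \<Rightarrow> 'k \<Rightarrow> 'k) (pullback_rep f (interval_module I))
      s (pullback_rep f M))"

definition tot :: "'a rel \<Rightarrow> ('a, 'a) compression" where
  "tot P I = (Restr P I, \<lambda>x. x)"

text \<open>Lists are indexed from \<open>0\<close>, so \<open>a\<^sub>i\<close> and \<open>b\<^sub>j\<close> are the entries at \<open>i - 1\<close> and
  \<open>j - 1\<close>. The relation \<^term>\<open>zz_gen P I\<close> consists of the generating relations;
  \<^term>\<open>zz_carrier P I\<close> contains all elements occurring in it.\<close>

definition zz_a :: "(nat \<times> nat) rel \<Rightarrow> (nat \<times> nat) set \<Rightarrow> (nat \<times> nat) list" where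
  "zz_a P I = (THE xs. set xs = sc P I \<and> sorted_wrt (<) (map fst xs))"

definition zz_b :: "(nat \<times> nat) rel \<Rightarrow> (nat \<times> nat) set \<Rightarrow> (nat \<times> nat) list" where
  "zz_b P I = (THE xs. set xs = sk P I \<and> sorted_wrt (<) (map fst xs))"

definition zz_join :: "(nat \<times> nat) rel \<Rightarrow> (nat \<times> nat) set \<Rightarrow> nat \<Rightarrow> nat \<times> nat" where
  "zz_join P I i = poset_join (Restr P I) (zz_a P I ! i) (zz_a P I ! Suc i)"

definition zz_meet :: "(nat \<times> nat) rel \<Rightarrow> (nat \<times> nat) set \<Rightarrow> nat \<Rightarrow> nat \<times> nat" where
  "zz_meet P I j = poset_meet (Restr P I) (zz_b P I ! j) (zz_b P I ! Suc j)"

definition zz_carrier :: "(nat \<times> nat) rel \<Rightarrow> (nat \<times> nat) set \<Rightarrow> (nat \<times> nat) set" where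
  "zz_carrier P I =
    sc P I \<union> {zz_join P I i | i. Suc i < length (zz_a P I)} \<union>
    sk P I \<union> {zz_meet P I j | j. Suc j < length (zz_b P I)}"

definition zz_gen :: "(nat \<times> nat) rel \<Rightarrow> (nat \<times> nat) set \<Rightarrow> (nat \<times> nat) rel" where
  "zz_gen P I =
    {(zz_a P I ! i, zz_join P I i) | i. Suc i < length (zz_a P I)} \<union>
    {(zz_a P I ! Suc i, zz_join P I i) | i. Suc i < length (zz_a P I)} \<union>
    {(zz_meet P I j, zz_b P I ! j) | j. Suc j < length (zz_b P I)} \<union>
    {(zz_meet P I j, zz_b P I ! Suc j) | j. Suc j < length (zz_b P I)} \<union>
    {(zz_a P I ! 0, zz_b P I ! 0)}"

definition zz :: "(nat \<times> nat) rel \<Rightarrow> (nat \<times> nat, nat \<times> nat) compression" where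
  "zz P I = (Id_on (zz_carrier P I) \<union> (zz_gen P I)\<^sup>+, \<lambda>x. x)"

text \<open>Both families are rank compression systems. In particular the joins and meets
  used for \<^const>\<open>zz\<close> exist in \<open>I\<close>.\<close>

lemma grid_iff:
  "(x, y) \<in> grid p q \<longleftrightarrow> x \<in> {1..p} \<times> {1..q} \<and> y \<in> {1..p} \<times> {1..q} \<and>
    fst x \<le> fst y \<and> snd x \<le> snd y"
  by (auto simp: grid_def relation_of_def)

lemma Field_grid: "Field (grid p q) = {1..p} \<times> {1..q}"
proof
  show "Field (grid p q) \<subseteq> {1..p} \<times> {1..q}" by (auto simp: Field_def grid_iff)
  have "(x, x) \<in> grid p q" if "x \<in> {1..p} \<times> {1..q}" for x using that by (simp add: grid_iff)
  then show "{1..p} \<times> {1..q} \<subseteq> Field (grid p q)" by (blast intro: FieldI1)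
qed

lemma finite_Field_grid: "finite (Field (grid p q))"
  by (simp add: Field_grid)

lemma grid_refl: "x \<in> Field (grid p q) \<Longrightarrow> (x, x) \<in> grid p q"
  by (auto simp: Field_grid grid_iff)

lemma grid_trans: "(x, y) \<in> grid p q \<Longrightarrow> (y, z) \<in> grid p q \<Longrightarrow> (x, z) \<in> grid p q"
  by (auto simp: grid_iff)

lemma grid_antisym: "(x, y) \<in> grid p q \<Longrightarrow> (y, x) \<in> grid p q \<Longrightarrow> x = y"
  by (auto simp: grid_iff prod_eq_iff)

lemma Field_Restr_grid:
  assumes "I \<subseteq> Field (grid p q)"
  shows "Field (Restr (grid p q) I) = I"
  using assms grid_refl by (fastforce simp: Field_def)

lemma Partial_order_Restr_grid:
  assumes "I \<subseteq> Field (grid p q)"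
  shows "Partial_order (Restr (grid p q) I)"
  unfolding Field_Restr_grid[OF assms] partial_order_on_def preorder_on_def
    refl_on_def trans_def antisym_def
  using assms grid_refl grid_trans grid_antisym by blast

lemma segment_interval:
  assumes "(x, y) \<in> grid p q"
  shows "interval (grid p q) {z. (x, z) \<in> grid p q \<and> (z, y) \<in> grid p q}"
    (is "interval ?P ?I")
proof -
  have x: "x \<in> ?I" using assms by (auto simp: grid_iff)
  have sub: "?I \<subseteq> Field ?P" by (auto simp: Field_def)
  have "(u, v) \<in> (Restr ?P ?I \<union> (Restr ?P ?I)\<inverse>)\<^sup>*" if "u \<in> ?I" "v \<in> ?I" for u v
  proof -
    have "(u, x) \<in> Restr ?P ?I \<union> (Restr ?P ?I)\<inverse>" "(x, v) \<in> Restr ?P ?I \<union> (Restr ?P ?I)\<inverse>"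
      using that x by auto
    then show ?thesis by (meson r_into_rtrancl rtrancl_trans)
  qed
  moreover have "(x, x) \<in> Restr ?P ?I" using x by auto
  ultimately have "connected_poset (Restr ?P ?I)"
    unfolding connected_poset_def Field_Restr_grid[OF sub] by blast
  moreover have "convex_in ?P ?I"
    unfolding convex_in_def using grid_trans by blast
  ultimately show ?thesis unfolding interval_def using x sub by blast
qed

lemma rank_compression_system_tot: "rank_compression_system (grid p q) (tot (grid p q))"
proof -
  have "compression_system (grid p q) (tot (grid p q))"
    unfolding compression_system_def
  proof (intro allI impI)
    fix I assume I: "interval (grid p q) I"
    then have sub: "I \<subseteq> Field (grid p q)" by (simp add: interval_def)
    have "finite I" using sub finite_Field_grid finite_subset by blast
    then show "case tot (grid p q) I of (Q, f) \<Rightarrow>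
      Partial_order Q \<and> finite (Field Q) \<and> connected_poset Q \<and>
      (\<forall>x y. (x, y) \<in> Q \<longrightarrow> (f x, f y) \<in> grid p q) \<and>
      f ` Field Q \<subseteq> I \<and> sc (grid p q) I \<union> sk (grid p q) I \<subseteq> f ` Field Q"
      using I Partial_order_Restr_grid[OF sub]
      by (auto simp: tot_def Field_Restr_grid[OF sub] interval_def sc_def sk_def)
  qed
  moreover have "case tot (grid p q) {z. (x, z) \<in> grid p q \<and> (z, y) \<in> grid p q} of (Q, f) \<Rightarrow>
      \<exists>x' y'. (x', y') \<in> Q \<and> f x' = x \<and> f y' = y" if "(x, y) \<in> grid p q" for x y
    using that by (auto simp: tot_def grid_iff)
  ultimately show ?thesis unfolding rank_compression_system_def by blast
qed

lemma sc_below: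
  assumes "I \<subseteq> Field (grid p q)" "z \<in> I"
  obtains a where "a \<in> sc (grid p q) I" "(a, z) \<in> grid p q"
proof -
  let ?S = "{w \<in> I. (w, z) \<in> grid p q}"
  have z: "z \<in> ?S" using assms grid_refl by blast
  define m where "m = (\<lambda>w. fst w + snd w :: nat)"
  obtain a where a: "a \<in> ?S" and min: "\<And>w. w \<in> ?S \<Longrightarrow> m a \<le> m w"
    using ex_has_least_nat[of "\<lambda>w. w \<in> ?S" z m] z by blast
  have "y = a" if "y \<in> I" "(y, a) \<in> grid p q" for y
  proof -
    have "m a \<le> m y" using min[of y] that a grid_trans by blast
    then show ?thesis using that by (auto simp: m_def grid_iff prod_eq_iff)
  qed
  then have "a \<in> sc (grid p q) I" using a by (auto simp: sc_def)
  then show thesis using that a by blast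
qed

lemma sk_above:
  assumes "I \<subseteq> Field (grid p q)" "z \<in> I"
  obtains b where "b \<in> sk (grid p q) I" "(z, b) \<in> grid p q"
proof -
  let ?S = "{w \<in> I. (z, w) \<in> grid p q}"
  have z: "z \<in> ?S" using assms grid_refl by blast
  define m where "m = (\<lambda>w. (p + q) - (fst w + snd w) :: nat)"
  obtain b where b: "b \<in> ?S" and min: "\<And>w. w \<in> ?S \<Longrightarrow> m b \<le> m w"
    using ex_has_least_nat[of "\<lambda>w. w \<in> ?S" z m] z by blast
  have "y = b" if "y \<in> I" "(b, y) \<in> grid p q" for y
  proof -
    have "m b \<le> m y" using min[of y] that b grid_trans by blast
    then show ?thesis using that by (auto simp: m_def grid_iff prod_eq_iff)
  qed
  then have "b \<in> sk (grid p q) I" using b by (auto simp: sk_def)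
  then show thesis using that b by blast
qed

lemma antichain_snd:
  assumes "I \<subseteq> Field (grid p q)"
  shows "a \<in> sc (grid p q) I \<Longrightarrow> a' \<in> sc (grid p q) I \<Longrightarrow> fst a < fst a' \<Longrightarrow> snd a' < snd a"
    and "b \<in> sk (grid p q) I \<Longrightarrow> b' \<in> sk (grid p q) I \<Longrightarrow> fst b < fst b' \<Longrightarrow> snd b' < snd b"
proof -
  have *: "(x, y) \<in> grid p q" if "x \<in> I" "y \<in> I" "fst x < fst y" "snd x \<le> snd y" for x y
    using assms that by (auto simp: Field_grid grid_iff)
  show "snd a' < snd a"
    if "a \<in> sc (grid p q) I" "a' \<in> sc (grid p q) I" "fst a < fst a'"
  proof (rule ccontr)
    assume "\<not> snd a' < snd a"
    then have "(a, a') \<in> grid p q" using * that by (simp add: sc_def)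
    then have "a = a'" using that unfolding sc_def by blast
    then show False using that by simp
  qed
  show "snd b' < snd b"
    if "b \<in> sk (grid p q) I" "b' \<in> sk (grid p q) I" "fst b < fst b'"
  proof (rule ccontr)
    assume "\<not> snd b' < snd b"
    then have "(b, b') \<in> grid p q" using * that by (simp add: sk_def)
    then have "b = b'" using that unfolding sk_def by blast
    then show False using that by simp
  qed
qed

lemma inj_on_fst_sc_sk:
  assumes "I \<subseteq> Field (grid p q)"
  shows "inj_on fst (sc (grid p q) I)" "inj_on fst (sk (grid p q) I)"
proof -
  have *: "(x, y) \<in> grid p q \<or> (y, x) \<in> grid p q" if "x \<in> I" "y \<in> I" "fst x = fst y" for x y
    using assms that by (auto simp: Field_grid grid_iff)
  show "inj_on fst (sc (grid p q) I)"
  proof (rule inj_onI)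
    fix x y assume xy: "x \<in> sc (grid p q) I" "y \<in> sc (grid p q) I" "fst x = fst y"
    then have "(x, y) \<in> grid p q \<or> (y, x) \<in> grid p q" using * by (simp add: sc_def)
    then show "x = y" using xy unfolding sc_def by blast
  qed
  show "inj_on fst (sk (grid p q) I)"
  proof (rule inj_onI)
    fix x y assume xy: "x \<in> sk (grid p q) I" "y \<in> sk (grid p q) I" "fst x = fst y"
    then have "(x, y) \<in> grid p q \<or> (y, x) \<in> grid p q" using * by (simp add: sk_def)
    then show "x = y" using xy unfolding sk_def by blast
  qed
qed

lemma the_fst_sorted_list:
  fixes A :: "(nat \<times> nat) set"
  assumes "finite A" "inj_on fst A"
  defines "xs \<equiv> THE xs. set xs = A \<and> sorted_wrt (<) (map fst xs)"
  shows "set xs = A \<and> sorted_wrt (<) (map fst xs)"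
  unfolding xs_def
proof (rule theI')
  obtain ys where ys: "set ys = A" "distinct ys"
    using finite_distinct_list[OF assms(1)] by blast
  have "distinct (map fst (sort_key fst ys))"
    using ys assms(2) by (simp add: distinct_map)
  then have ex: "set (sort_key fst ys) = A" "sorted_wrt (<) (map fst (sort_key fst ys))"
    using ys by (simp_all add: strict_sorted_iff)
  have "xs = zs" if "set xs = A" "sorted_wrt (<) (map fst xs)"
    "set zs = A" "sorted_wrt (<) (map fst zs)" for xs zs
  proof -
    have "map fst xs = map fst zs" using that by (intro strict_sorted_equal) simp_all
    then show ?thesis using assms(2) that by (simp add: inj_on_map_eq_map)
  qed
  then show "\<exists>!xs. set xs = A \<and> sorted_wrt (<) (map fst xs)" using ex by blast
qed

lemma zz_lists:
  assumes "I \<subseteq> Field (grid p q)"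
  shows "set (zz_a (grid p q) I) = sc (grid p q) I"
    and "sorted_wrt (<) (map fst (zz_a (grid p q) I))"
    and "set (zz_b (grid p q) I) = sk (grid p q) I"
    and "sorted_wrt (<) (map fst (zz_b (grid p q) I))"
proof -
  have fin: "finite (sc (grid p q) I)" "finite (sk (grid p q) I)"
    using finite_subset[OF assms finite_Field_grid] by (auto simp: sc_def sk_def)
  note A = the_fst_sorted_list[OF fin(1) inj_on_fst_sc_sk(1)[OF assms]]
  note B = the_fst_sorted_list[OF fin(2) inj_on_fst_sc_sk(2)[OF assms]]
  show "set (zz_a (grid p q) I) = sc (grid p q) I"
    and "sorted_wrt (<) (map fst (zz_a (grid p q) I))"
    using A by (simp_all add: zz_a_def)
  show "set (zz_b (grid p q) I) = sk (grid p q) I"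
    and "sorted_wrt (<) (map fst (zz_b (grid p q) I))"
    using B by (simp_all add: zz_b_def)
qed

lemma connected_split:
  assumes conn: "connected_poset r" and cover: "Field r \<subseteq> U \<union> W"
    and "u \<in> U \<inter> Field r" "w \<in> W \<inter> Field r"
  shows "\<exists>x y. x \<in> U \<and> y \<in> W \<and> ((x, y) \<in> r \<or> (y, x) \<in> r \<or> x = y \<and> x \<in> Field r)"
proof (rule ccontr)
  assume no: "\<not> ?thesis"
  have "(u, w) \<in> (r \<union> r\<inverse>)\<^sup>*" using assms unfolding connected_poset_def by blast
  then have "w \<in> U"
  proof (induction rule: rtrancl_induct)
    case base
    then show ?case using assms by blast
  next
    case (step y z)
    then have "z \<in> Field r" by (auto simp: Field_def)
    then show ?case using step no cover by blast
  qed
  then show False using no assms by blast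
qed

lemma sorted_fst_less:
  assumes "sorted_wrt (<) (map fst xs)" "i < j" "j < length xs"
  shows "fst (xs ! i) < fst (xs ! j :: nat \<times> nat)"
  using assms by (simp add: sorted_wrt_iff_nth_less)

lemma sorted_fst_le:
  assumes "sorted_wrt (<) (map fst xs)" "i \<le> j" "j < length xs"
  shows "fst (xs ! i) \<le> fst (xs ! j :: nat \<times> nat)"
  using sorted_fst_less[OF assms(1), of i j] assms by (cases "i = j") auto

lemma zz_a_snd_less:
  assumes "I \<subseteq> Field (grid p q)" "i < j" "j < length (zz_a (grid p q) I)"
  shows "snd (zz_a (grid p q) I ! j) < snd (zz_a (grid p q) I ! i)"
proof (rule antichain_snd(1)[OF assms(1)])
  show "zz_a (grid p q) I ! i \<in> sc (grid p q) I"
    and "zz_a (grid p q) I ! j \<in> sc (grid p q) I"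
    using assms(2,3) by (simp_all flip: zz_lists(1)[OF assms(1)])
  show "fst (zz_a (grid p q) I ! i) < fst (zz_a (grid p q) I ! j)"
    using sorted_fst_less[OF zz_lists(2)[OF assms(1)] assms(2,3)] .
qed

lemma zz_b_snd_less:
  assumes "I \<subseteq> Field (grid p q)" "i < j" "j < length (zz_b (grid p q) I)"
  shows "snd (zz_b (grid p q) I ! j) < snd (zz_b (grid p q) I ! i)"
proof (rule antichain_snd(2)[OF assms(1)])
  show "zz_b (grid p q) I ! i \<in> sk (grid p q) I"
    and "zz_b (grid p q) I ! j \<in> sk (grid p q) I"
    using assms(2,3) by (simp_all flip: zz_lists(3)[OF assms(1)])
  show "fst (zz_b (grid p q) I ! i) < fst (zz_b (grid p q) I ! j)"
    using sorted_fst_less[OF zz_lists(4)[OF assms(1)] assms(2,3)] .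
qed

lemma zz_join_eq:
  assumes I: "interval (grid p q) I" and i: "Suc i < length (zz_a (grid p q) I)"
  defines "a \<equiv> zz_a (grid p q) I ! i" and "a' \<equiv> zz_a (grid p q) I ! Suc i"
  shows "zz_join (grid p q) I i = (fst a', snd a)" (is "_ = ?c")
    and "(a, (fst a', snd a)) \<in> Restr (grid p q) I"
    and "(a', (fst a', snd a)) \<in> Restr (grid p q) I"
proof -
  let ?P = "grid p q" and ?as = "zz_a (grid p q) I"
  have sub: "I \<subseteq> Field ?P" and conv: "convex_in ?P I" and conn: "connected_poset (Restr ?P I)"
    using I by (auto simp: interval_def)
  note set_a = zz_lists(1)[OF sub] and srt = zz_lists(2)[OF sub]
  have aI: "?as ! k \<in> I" if "k < length ?as" for k
    using that set_a nth_mem[OF that] by (auto simp: sc_def)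
  have lt: "fst a < fst a'" "snd a' < snd a"
    unfolding a_def a'_def using sorted_fst_less[OF srt _ i] zz_a_snd_less[OF sub _ i] by auto
  define U where "U = {z \<in> I. \<exists>k\<le>i. (?as ! k, z) \<in> ?P}"
  define W where "W = {z \<in> I. \<exists>k. i < k \<and> k < length ?as \<and> (?as ! k, z) \<in> ?P}"
  have cover: "I \<subseteq> U \<union> W"
  proof
    fix z assume z: "z \<in> I"
    then obtain b where "b \<in> sc ?P I" "(b, z) \<in> ?P" using sc_below[OF sub] by blast
    then obtain k where "k < length ?as" "(?as ! k, z) \<in> ?P"
      using set_a by (metis in_set_conv_nth)
    then show "z \<in> U \<union> W" using z by (cases "k \<le> i") (auto simp: U_def W_def)
  qed
  have a2: "a \<in> I" "a' \<in> I" using aI[of i] aI[of "Suc i"] i by (auto simp: a_def a'_def)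
  then have "(a, a) \<in> ?P" "(a', a') \<in> ?P" using sub grid_refl by blast+
  then have "a \<in> U" "a' \<in> W"
    using a2 i unfolding U_def W_def a_def a'_def by blast+
  then have "\<exists>x y. x \<in> U \<and> y \<in> W \<and>
      ((x, y) \<in> Restr ?P I \<or> (y, x) \<in> Restr ?P I \<or> x = y \<and> x \<in> Field (Restr ?P I))"
    using cover
    by (intro connected_split[OF conn, of U W a a']) (auto simp: Field_Restr_grid[OF sub] U_def W_def)
  then obtain z where "z \<in> U" "z \<in> W"
    unfolding U_def W_def using grid_trans by blast
  then obtain k l where z: "z \<in> I" and k: "k \<le> i" "(?as ! k, z) \<in> ?P"
    and l: "i < l" "l < length ?as" "(?as ! l, z) \<in> ?P"
    unfolding U_def W_def by blast
  have "snd a \<le> snd (?as ! k)"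
    using zz_a_snd_less[OF sub, of k i] k i by (cases "k = i") (auto simp: a_def)
  moreover have "fst a' \<le> fst (?as ! l)"
    unfolding a'_def using sorted_fst_le[OF srt, of "Suc i" l] l by auto
  ultimately have cz: "(?c, z) \<in> ?P"
    using k l sub z a2
    by (auto simp: grid_iff Field_grid mem_Times_iff)
  have ac: "(a, ?c) \<in> ?P" "(a', ?c) \<in> ?P"
    using lt cz sub a2
    by (auto simp: grid_iff Field_grid mem_Times_iff)
  have c: "?c \<in> I"
    using conv ac(1) cz z aI[of i] i unfolding convex_in_def a_def by (meson Suc_lessD)
  show 1: "(a, ?c) \<in> Restr ?P I" and 2: "(a', ?c) \<in> Restr ?P I"
    using ac c aI[of i] aI[of "Suc i"] i by (auto simp: a_def a'_def)
  show "zz_join ?P I i = ?c"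
    unfolding zz_join_def poset_join_def a_def[symmetric] a'_def[symmetric]
  proof (rule the_equality)
    show least: "(a, ?c) \<in> Restr ?P I \<and> (a', ?c) \<in> Restr ?P I \<and>
      (\<forall>w. (a, w) \<in> Restr ?P I \<longrightarrow> (a', w) \<in> Restr ?P I \<longrightarrow> (?c, w) \<in> Restr ?P I)"
    proof (intro conjI allI impI 1 2)
      fix w assume w: "(a, w) \<in> Restr ?P I" "(a', w) \<in> Restr ?P I"
      then have "(?c, w) \<in> ?P" using 1 by (simp add: grid_iff)
      then show "(?c, w) \<in> Restr ?P I" using w c by blast
    qed
    show "w = ?c" if "(a, w) \<in> Restr ?P I \<and> (a', w) \<in> Restr ?P I \<and>
      (\<forall>v. (a, v) \<in> Restr ?P I \<longrightarrow> (a', v) \<in> Restr ?P I \<longrightarrow> (w, v) \<in> Restr ?P I)" for w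
      using that least grid_antisym[of w ?c] by blast
  qed
qed

lemma zz_meet_eq:
  assumes I: "interval (grid p q) I" and i: "Suc i < length (zz_b (grid p q) I)"
  defines "b \<equiv> zz_b (grid p q) I ! i" and "b' \<equiv> zz_b (grid p q) I ! Suc i"
  shows "zz_meet (grid p q) I i = (fst b, snd b')" (is "_ = ?c")
    and "((fst b, snd b'), b) \<in> Restr (grid p q) I"
    and "((fst b, snd b'), b') \<in> Restr (grid p q) I"
proof -
  let ?P = "grid p q" and ?bs = "zz_b (grid p q) I"
  have sub: "I \<subseteq> Field ?P" and conv: "convex_in ?P I" and conn: "connected_poset (Restr ?P I)"
    using I by (auto simp: interval_def)
  note set_b = zz_lists(3)[OF sub] and srt = zz_lists(4)[OF sub]
  have bI: "?bs ! k \<in> I" if "k < length ?bs" for k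
    using that set_b nth_mem[OF that] by (auto simp: sk_def)
  have lt: "fst b < fst b'" "snd b' < snd b"
    unfolding b_def b'_def using sorted_fst_less[OF srt _ i] zz_b_snd_less[OF sub _ i] by auto
  define U where "U = {z \<in> I. \<exists>k\<le>i. (z, ?bs ! k) \<in> ?P}"
  define W where "W = {z \<in> I. \<exists>k. i < k \<and> k < length ?bs \<and> (z, ?bs ! k) \<in> ?P}"
  have cover: "I \<subseteq> U \<union> W"
  proof
    fix z assume z: "z \<in> I"
    then obtain b where "b \<in> sk ?P I" "(z, b) \<in> ?P" using sk_above[OF sub] by blast
    then obtain k where "k < length ?bs" "(z, ?bs ! k) \<in> ?P"
      using set_b by (metis in_set_conv_nth)
    then show "z \<in> U \<union> W" using z by (cases "k \<le> i") (auto simp: U_def W_def)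
  qed
  have b2: "b \<in> I" "b' \<in> I" using bI[of i] bI[of "Suc i"] i by (auto simp: b_def b'_def)
  then have "(b, b) \<in> ?P" "(b', b') \<in> ?P" using sub grid_refl by blast+
  then have "b \<in> U" "b' \<in> W"
    using b2 i unfolding U_def W_def b_def b'_def by blast+
  then have "\<exists>x y. x \<in> U \<and> y \<in> W \<and>
      ((x, y) \<in> Restr ?P I \<or> (y, x) \<in> Restr ?P I \<or> x = y \<and> x \<in> Field (Restr ?P I))"
    using cover
    by (intro connected_split[OF conn, of U W b b']) (auto simp: Field_Restr_grid[OF sub] U_def W_def)
  then obtain z where "z \<in> U" "z \<in> W"
    unfolding U_def W_def using grid_trans by blast
  then obtain k l where z: "z \<in> I" and k: "k \<le> i" "(z, ?bs ! k) \<in> ?P"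
    and l: "i < l" "l < length ?bs" "(z, ?bs ! l) \<in> ?P"
    unfolding U_def W_def by blast
  have "snd (?bs ! l) \<le> snd b'"
    using zz_b_snd_less[OF sub, of "Suc i" l] l by (cases "l = Suc i") (auto simp: b'_def)
  moreover have "fst (?bs ! k) \<le> fst b"
    unfolding b_def using sorted_fst_le[OF srt, of k i] k i by auto
  ultimately have cz: "(z, ?c) \<in> ?P"
    using k l sub z b2
    by (auto simp: grid_iff Field_grid mem_Times_iff)
  have bc: "(?c, b) \<in> ?P" "(?c, b') \<in> ?P"
    using lt cz sub b2
    by (auto simp: grid_iff Field_grid mem_Times_iff)
  have c: "?c \<in> I"
    using conv bc(1) cz z bI[of i] i unfolding convex_in_def b_def by (meson Suc_lessD)
  show 1: "(?c, b) \<in> Restr ?P I" and 2: "(?c, b') \<in> Restr ?P I"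
    using bc c bI[of i] bI[of "Suc i"] i by (auto simp: b_def b'_def)
  show "zz_meet ?P I i = ?c"
    unfolding zz_meet_def poset_meet_def b_def[symmetric] b'_def[symmetric]
  proof (rule the_equality)
    show greatest: "(?c, b) \<in> Restr ?P I \<and> (?c, b') \<in> Restr ?P I \<and>
      (\<forall>w. (w, b) \<in> Restr ?P I \<longrightarrow> (w, b') \<in> Restr ?P I \<longrightarrow> (w, ?c) \<in> Restr ?P I)"
    proof (intro conjI allI impI 1 2)
      fix w assume w: "(w, b) \<in> Restr ?P I" "(w, b') \<in> Restr ?P I"
      then have "(w, ?c) \<in> ?P" using 1 by (simp add: grid_iff)
      then show "(w, ?c) \<in> Restr ?P I" using w c by blast
    qed
    show "w = ?c" if "(w, b) \<in> Restr ?P I \<and> (w, b') \<in> Restr ?P I \<and>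
      (\<forall>v. (v, b) \<in> Restr ?P I \<longrightarrow> (v, b') \<in> Restr ?P I \<longrightarrow> (v, w) \<in> Restr ?P I)" for w
      using that greatest grid_antisym[of w ?c] by blast
  qed
qed

lemma zz_lists_nonempty:
  assumes "interval (grid p q) I"
  shows "zz_a (grid p q) I \<noteq> []" "zz_b (grid p q) I \<noteq> []"
proof -
  have sub: "I \<subseteq> Field (grid p q)" using assms by (simp add: interval_def)
  obtain z where "z \<in> I" using assms by (auto simp: interval_def)
  then obtain a b where "a \<in> sc (grid p q) I" "b \<in> sk (grid p q) I"
    using sc_below[OF sub] sk_above[OF sub] by metis
  then show "zz_a (grid p q) I \<noteq> []" "zz_b (grid p q) I \<noteq> []"
    using zz_lists(1,3)[OF sub] by auto
qed

lemma zz_first_le: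
  assumes "interval (grid p q) I"
  shows "(zz_a (grid p q) I ! 0, zz_b (grid p q) I ! 0) \<in> Restr (grid p q) I"
proof -
  let ?as = "zz_a (grid p q) I" and ?bs = "zz_b (grid p q) I"
  have sub: "I \<subseteq> Field (grid p q)" using assms by (simp add: interval_def)
  note ne = zz_lists_nonempty[OF assms]
  have a0: "?as ! 0 \<in> sc (grid p q) I" and b0: "?bs ! 0 \<in> sk (grid p q) I"
    using ne zz_lists(1,3)[OF sub] nth_mem by blast+
  then have I: "?as ! 0 \<in> I" "?bs ! 0 \<in> I" by (auto simp: sc_def sk_def)
  obtain a where "a \<in> sc (grid p q) I" "(a, ?bs ! 0) \<in> grid p q" using sc_below[OF sub I(2)] .
  then obtain i where i: "i < length ?as" "(?as ! i, ?bs ! 0) \<in> grid p q"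
    using zz_lists(1)[OF sub] by (metis in_set_conv_nth)
  obtain b where "b \<in> sk (grid p q) I" "(?as ! 0, b) \<in> grid p q" using sk_above[OF sub I(1)] .
  then obtain j where j: "j < length ?bs" "(?as ! 0, ?bs ! j) \<in> grid p q"
    using zz_lists(3)[OF sub] by (metis in_set_conv_nth)
  have "fst (?as ! 0) \<le> fst (?as ! i)"
    using sorted_fst_le[OF zz_lists(2)[OF sub], of 0 i] i by auto
  moreover have "snd (?bs ! j) \<le> snd (?bs ! 0)"
    using zz_b_snd_less[OF sub, of 0 j] j by (cases "j = 0") auto
  ultimately show ?thesis using i j I by (auto simp: grid_iff)
qed

lemma zz_gen_subset:
  assumes "interval (grid p q) I"
  shows "zz_gen (grid p q) I \<subseteq> Restr (grid p q) I"
    and "zz_gen (grid p q) I \<subseteq> zz_carrier (grid p q) I \<times> zz_carrier (grid p q) I"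
    and "zz_carrier (grid p q) I \<subseteq> I"
proof -
  have sub: "I \<subseteq> Field (grid p q)" using assms by (simp add: interval_def)
  have J: "(zz_a (grid p q) I ! i, zz_join (grid p q) I i) \<in> Restr (grid p q) I"
    "(zz_a (grid p q) I ! Suc i, zz_join (grid p q) I i) \<in> Restr (grid p q) I"
    if "Suc i < length (zz_a (grid p q) I)" for i
    unfolding zz_join_eq(1)[OF assms that] by (rule zz_join_eq(2,3)[OF assms that])+
  have K: "(zz_meet (grid p q) I i, zz_b (grid p q) I ! i) \<in> Restr (grid p q) I"
    "(zz_meet (grid p q) I i, zz_b (grid p q) I ! Suc i) \<in> Restr (grid p q) I"
    if "Suc i < length (zz_b (grid p q) I)" for i
    unfolding zz_meet_eq(1)[OF assms that] by (rule zz_meet_eq(2,3)[OF assms that])+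
  show "zz_gen (grid p q) I \<subseteq> Restr (grid p q) I"
    unfolding zz_gen_def
    using J K zz_first_le[OF assms] by blast
  have "zz_a (grid p q) I ! i \<in> sc (grid p q) I" if "i < length (zz_a (grid p q) I)" for i
    using nth_mem[OF that] unfolding zz_lists(1)[OF sub] .
  moreover have "zz_b (grid p q) I ! i \<in> sk (grid p q) I" if "i < length (zz_b (grid p q) I)" for i
    using nth_mem[OF that] unfolding zz_lists(3)[OF sub] .
  ultimately show "zz_gen (grid p q) I \<subseteq> zz_carrier (grid p q) I \<times> zz_carrier (grid p q) I"
    using zz_lists_nonempty[OF assms]
    unfolding zz_gen_def zz_carrier_def by (blast dest: Suc_lessD)
  show "zz_carrier (grid p q) I \<subseteq> I"
    unfolding zz_carrier_def sc_def sk_def using J K by blast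
qed

lemma chain_connected:
  fixes xs :: "'a list"
  assumes "\<And>i. Suc i < length xs \<Longrightarrow> (xs ! i, xs ! Suc i) \<in> R\<^sup>*"
  shows "i < length xs \<Longrightarrow> (xs ! 0, xs ! i) \<in> R\<^sup>*"
proof (induction i)
  case (Suc i)
  then show ?case using assms[of i] by (meson Suc_lessD rtrancl_trans)
qed simp

lemma rank_compression_system_zz: "rank_compression_system (grid p q) (zz (grid p q))"
proof -
  let ?P = "grid p q"
  have "compression_system ?P (zz ?P)"
    unfolding compression_system_def
  proof (intro allI impI)
    fix I assume I: "interval ?P I"
    then have sub: "I \<subseteq> Field ?P" by (simp add: interval_def)
    let ?C = "zz_carrier ?P I" and ?G = "zz_gen ?P I"
    let ?as = "zz_a ?P I" and ?bs = "zz_b ?P I"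
    note gen = zz_gen_subset[OF I]
    define Q where "Q = Id_on ?C \<union> ?G\<^sup>+"
    have trancl: "?G\<^sup>+ \<subseteq> ?C \<times> ?C" using gen(2) by (rule trancl_subset_Sigma)
    then have Fld: "Field Q = ?C" by (auto simp: Q_def Field_def)
    have "trans (Restr ?P I)" using grid_trans unfolding trans_def by blast
    then have "?G\<^sup>+ \<subseteq> Restr ?P I" using gen(1) by (metis trancl_id trancl_mono_subset)
    moreover have "Id_on ?C \<subseteq> Restr ?P I"
    proof
      fix e assume "e \<in> Id_on ?C"
      then obtain x where "e = (x, x)" "x \<in> I" using gen(3) by blast
      then show "e \<in> Restr ?P I" using sub grid_refl by blast
    qed
    ultimately have QP: "Q \<subseteq> Restr ?P I" by (simp add: Q_def)
    have "trans Q" unfolding Q_def trans_def by (auto intro: trancl_trans)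
    moreover have "antisym Q" using QP grid_antisym unfolding antisym_def by blast
    ultimately have po: "Partial_order Q"
      unfolding Fld partial_order_on_def preorder_on_def refl_on_def
      using trancl by (auto simp: Q_def)
    define R where "R = (Q \<union> Q\<inverse>)\<^sup>*"
    have symR: "(x, y) \<in> R \<Longrightarrow> (y, x) \<in> R" for x y
      unfolding R_def by (metis sym_Un_converse sym_rtrancl symD)
    have transR: "(x, y) \<in> R \<Longrightarrow> (y, z) \<in> R \<Longrightarrow> (x, z) \<in> R" for x y z
      unfolding R_def by (rule rtrancl_trans)
    have GR: "(x, y) \<in> ?G \<Longrightarrow> (x, y) \<in> R" for x y
      unfolding R_def Q_def by (blast intro: r_into_rtrancl)
    note ne = zz_lists_nonempty[OF I]
    have J: "(?as ! i, zz_join ?P I i) \<in> R" "(?as ! Suc i, zz_join ?P I i) \<in> R"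
      if "Suc i < length ?as" for i
      using that by (auto intro!: GR simp: zz_gen_def)
    have K: "(zz_meet ?P I i, ?bs ! i) \<in> R" "(zz_meet ?P I i, ?bs ! Suc i) \<in> R"
      if "Suc i < length ?bs" for i
      using that by (auto intro!: GR simp: zz_gen_def)
    have as0: "(?as ! 0, ?as ! i) \<in> R" if "i < length ?as" for i
      unfolding R_def by (rule chain_connected[OF _ that]) (metis J R_def symR transR)
    have bs0: "(?bs ! 0, ?bs ! i) \<in> R" if "i < length ?bs" for i
      unfolding R_def by (rule chain_connected[OF _ that]) (metis K R_def symR transR)
    have ab: "(?as ! 0, ?bs ! 0) \<in> R" by (rule GR) (simp add: zz_gen_def)
    have base: "(?as ! 0, x) \<in> R" if "x \<in> ?C" for x
    proof -
      consider i where "i < length ?as" "x = ?as ! i"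
        | i where "Suc i < length ?as" "x = zz_join ?P I i"
        | i where "i < length ?bs" "x = ?bs ! i"
        | i where "Suc i < length ?bs" "x = zz_meet ?P I i"
        using \<open>x \<in> ?C\<close>
        unfolding zz_carrier_def zz_lists(1,3)[OF sub, symmetric] set_conv_nth by blast
      then show ?thesis
      proof cases
        case 1
        then show ?thesis using as0 by blast
      next
        case 2
        then show ?thesis using as0[of i] J[of i] transR by (meson Suc_lessD)
      next
        case 3
        then show ?thesis using bs0 ab transR by blast
      next
        case 4
        then show ?thesis using bs0[of i] K[of i] ab transR symR by (meson Suc_lessD)
      qed
    qed
    have "Q \<noteq> {}" using ne unfolding Q_def zz_gen_def by auto
    then have conn: "connected_poset Q"
      unfolding connected_poset_def Fld using base symR transR unfolding R_def by blast
    have "finite ?C" using gen(3) sub finite_Field_grid by (meson finite_subset)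
    then show "case zz ?P I of (Q, f) \<Rightarrow>
      Partial_order Q \<and> finite (Field Q) \<and> connected_poset Q \<and>
      (\<forall>x y. (x, y) \<in> Q \<longrightarrow> (f x, f y) \<in> ?P) \<and>
      f ` Field Q \<subseteq> I \<and> sc ?P I \<union> sk ?P I \<subseteq> f ` Field Q"
      unfolding zz_def Q_def[symmetric] prod.case Fld image_ident
      using po conn QP gen(3) unfolding Fld zz_carrier_def by blast
  qed
  moreover have "case zz ?P {z. (x, z) \<in> ?P \<and> (z, y) \<in> ?P} of (Q, f) \<Rightarrow>
      \<exists>x' y'. (x', y') \<in> Q \<and> f x' = x \<and> f y' = y" if xy: "(x, y) \<in> ?P" for x y
  proof -
    let ?I = "{z. (x, z) \<in> ?P \<and> (z, y) \<in> ?P}"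
    have I: "interval ?P ?I" using segment_interval[OF xy] .
    then have sub: "?I \<subseteq> Field ?P" by (simp add: interval_def)
    have "x \<in> ?I" "y \<in> ?I" using xy by (auto simp: grid_iff)
    then have "sc ?P ?I = {x}" "sk ?P ?I = {y}"
      unfolding sc_def sk_def by (blast dest: grid_antisym)+
    then have "zz_a ?P ?I ! 0 = x" "zz_b ?P ?I ! 0 = y"
      using zz_lists(1,3)[OF sub] zz_lists_nonempty[OF I] nth_mem by blast+
    then have "(x, y) \<in> zz_gen ?P ?I" unfolding zz_gen_def by simp
    then show ?thesis unfolding zz_def prod.case by blast
  qed
  ultimately show ?thesis unfolding rank_compression_system_def by blast
qed

end

theory Submission
  imports Defs
begin

text \<open>Let \<open>Q\<close> be a connected finite poset. A section of a representation \<open>N\<close> is an element of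
  \<open>lim N\<close>, a cosection a linear functional on \<open>colim N\<close>. A section and a cosection of an
  indecomposable summand that pair to a nonzero scalar split off the constant
  representation, so its multiplicity in \<open>N\<close> is the rank of the pairing, that is, of
  \<open>lim N \<rightarrow> colim N\<close>: the largest size of a system of sections and cosections dual to
  each other. For an interval \<open>I\<close> of the grid, the values of a section on \<open>I\<^sup>z\<^sup>z\<close> at the minimal
  elements extend uniquely to a section on \<open>I\<close>: the minimal elements below a point \<open>z\<close> are consecutive,
  and so are linked by joins below \<open>z\<close>. Dually for cosections and maximal elements. The
  relation \<open>a\<^sub>1 \<le> b\<^sub>1\<close> shows that the extensions have the same pairing.\<close>

section \<open>Sections, cosections and their pairing\<close>

definition section_of :: "'p rel \<Rightarrow> ('p, 'v) rep \<Rightarrow> ('p \<Rightarrow> 'v) \<Rightarrow> bool" where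
  "section_of Q N v \<longleftrightarrow> (\<forall>x\<in>Field Q. v x \<in> vspace N x) \<and>
    (\<forall>x y. (x, y) \<in> Q \<longrightarrow> act N y x (v x) = v y)"

definition cosection_of ::
  "('k::field \<Rightarrow> 'v::ab_group_add \<Rightarrow> 'v) \<Rightarrow> 'p rel \<Rightarrow> ('p, 'v) rep \<Rightarrow> ('p \<Rightarrow> 'v \<Rightarrow> 'k) \<Rightarrow> bool" where
  "cosection_of s Q N l \<longleftrightarrow>
    (\<forall>x\<in>Field Q. linear_between s (*) (vspace N x) UNIV (l x)) \<and>
    (\<forall>x y. (x, y) \<in> Q \<longrightarrow> (\<forall>u\<in>vspace N x. l y (act N y x u) = l x u))"

text \<open>Duality is stated at every point, so that it passes to a subrelation at once. On a
  connected poset the scalar \<open>l i x (v j x)\<close> is the same at all points by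
  \<open>pairing_constant\<close>, so the condition says that the pairing matrix of the two families
  is the identity.\<close>

definition dual_system ::
  "('k::field \<Rightarrow> 'v::ab_group_add \<Rightarrow> 'v) \<Rightarrow> 'p rel \<Rightarrow> ('p, 'v) rep \<Rightarrow> nat \<Rightarrow> bool" where
  "dual_system s Q N m \<longleftrightarrow> (\<exists>v l.
    (\<forall>i<m. section_of Q N (v i)) \<and> (\<forall>i<m. cosection_of s Q N (l i)) \<and>
    (\<forall>i<m. \<forall>j<m. \<forall>x\<in>Field Q. l i x (v j x) = (if i = j then 1 else 0)))"

lemma sum_lessThan_add:
  fixes f :: "nat \<Rightarrow> 'a::comm_monoid_add"
  shows "(\<Sum>i<n + m. f i) = (\<Sum>i<n. f i) + (\<Sum>i<m. f (n + i))"
  by (induction m) (simp_all add: add.assoc)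

lemma connected_poset_constant:
  assumes "connected_poset Q" and "x \<in> Field Q" "y \<in> Field Q"
    and "\<And>x y. (x, y) \<in> Q \<Longrightarrow> f x = f y"
  shows "f x = f y"
proof -
  have "(x, y) \<in> (Q \<union> Q\<inverse>)\<^sup>*" using assms unfolding connected_poset_def by blast
  then show ?thesis by (induction rule: rtrancl_induct) (use assms(4) in \<open>auto\<close>)
qed

text \<open>A relation from \<open>x\<close> to \<open>y\<close> carries \<open>v x\<close> to
  \<open>v y\<close> and pulls \<open>l y\<close> back to \<open>l x\<close>, so the scalar does not
  change along it; connectedness does the rest.\<close>

lemma pairing_constant:
  assumes "connected_poset Q" "section_of Q N v" "cosection_of s Q N l"
    and "x \<in> Field Q" "y \<in> Field Q"
  shows "l x (v x) = l y (v y)"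
proof (rule connected_poset_constant[OF assms(1,4,5)])
  fix x y assume xy: "(x, y) \<in> Q"
  then have "v x \<in> vspace N x" using assms(2) by (auto simp: section_of_def Field_def)
  then have "l y (act N y x (v x)) = l x (v x)"
    using assms(3) xy by (simp add: cosection_of_def)
  then show "l x (v x) = l y (v y)"
    using assms(2) xy by (simp add: section_of_def)
qed

lemma FieldD: "(x, y) \<in> Q \<Longrightarrow> x \<in> Field Q \<and> y \<in> Field Q"
  by (auto simp: Field_def)

lemma linear_between_mono:
  "linear_between s t V W f \<Longrightarrow> U \<subseteq> V \<Longrightarrow> f ` U \<subseteq> T \<Longrightarrow> linear_between s t U T f"
  unfolding linear_between_def by blast

lemma linear_between_comp:
  "linear_between s t V W f \<Longrightarrow> linear_between t r W T g \<Longrightarrow> linear_between s r V T (\<lambda>u. g (f u))"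
  unfolding linear_between_def by (auto simp: Pi_iff)

lemma section_ofD:
  assumes "section_of Q N v"
  shows "x \<in> Field Q \<Longrightarrow> v x \<in> vspace N x" and "(x, y) \<in> Q \<Longrightarrow> act N y x (v x) = v y"
  using assms by (simp_all add: section_of_def)

lemma cosection_ofD:
  assumes "cosection_of s Q N l"
  shows "x \<in> Field Q \<Longrightarrow> linear_between s (*) (vspace N x) UNIV (l x)"
    and "(x, y) \<in> Q \<Longrightarrow> u \<in> vspace N x \<Longrightarrow> l y (act N y x u) = l x u"
  using assms by (simp_all add: cosection_of_def)

lemma pullback_rep_ident: "pullback_rep (\<lambda>x. x) N = N"
  by (simp add: pullback_rep_def)

text \<open>The subrelation may be full or not. This covers both the interval with its induced order
  and the zigzag poset, whose order can be strictly weaker.\<close>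

lemma is_rep_subset: "is_rep s P M \<Longrightarrow> Q \<subseteq> P \<Longrightarrow> is_rep s Q M"
  unfolding is_rep_def using mono_Field[of Q P] by (auto simp: subset_iff)

lemma section_of_subset: "section_of P N v \<Longrightarrow> Q \<subseteq> P \<Longrightarrow> section_of Q N v"
  unfolding section_of_def using mono_Field[of Q P] by (auto simp: subset_iff)

lemma cosection_of_subset: "cosection_of s P N l \<Longrightarrow> Q \<subseteq> P \<Longrightarrow> cosection_of s Q N l"
  unfolding cosection_of_def using mono_Field[of Q P] by (auto simp: subset_iff)

lemma cosection_of_subrep:
  assumes "cosection_of s Q N l" and sub: "\<And>x. x \<in> Field Q \<Longrightarrow> U x \<subseteq> vspace N x"
  shows "cosection_of s Q (N\<lparr>vspace := U\<rparr>) l"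
proof -
  have "linear_between s (*) (U x) UNIV (l x)" if x: "x \<in> Field Q" for x
  proof (rule linear_between_mono)
    show "linear_between s (*) (vspace N x) UNIV (l x)"
      using assms(1) x by (simp add: cosection_of_def)
  qed (use sub[OF x] in auto)
  moreover have "l y (act N y x u) = l x u" if "(x, y) \<in> Q" "u \<in> U x" for x y u
    using assms(1) that subsetD[OF sub[OF FieldI1[OF that(1)]]] by (simp add: cosection_of_def)
  ultimately show ?thesis by (simp add: cosection_of_def)
qed

text \<open>Restricting sections and cosections keeps all their pairings. This is the trivial half
  of the comparison: whatever size occurs on the interval occurs on the zigzag poset.\<close>

lemma dual_system_subset:
  assumes "dual_system s P N m" "Q \<subseteq> P"
  shows "dual_system s Q N m"
proof -
  obtain v l where vl: "\<forall>i<m. section_of P N (v i)" "\<forall>i<m. cosection_of s P N (l i)"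
    "\<forall>i<m. \<forall>j<m. \<forall>x\<in>Field P. l i x (v j x) = (if i = j then 1 else 0)"
    using assms(1) unfolding dual_system_def by blast
  have "\<forall>i<m. section_of Q N (v i)"
    by (intro allI impI section_of_subset[OF vl(1)[rule_format] assms(2)])
  moreover have "\<forall>i<m. cosection_of s Q N (l i)"
    by (intro allI impI cosection_of_subset[OF vl(2)[rule_format] assms(2)])
  moreover have "\<forall>i<m. \<forall>j<m. \<forall>x\<in>Field Q. l i x (v j x) = (if i = j then 1 else 0)"
    using vl(3) subsetD[OF mono_Field[OF assms(2)]] by simp
  ultimately show ?thesis unfolding dual_system_def by (intro exI conjI)
qed

section \<open>Linear algebra in finite-dimensional subspaces\<close>

context vector_space
begin

lemma linear_between_zero:
  "subspace V \<Longrightarrow> linear_between scale t V W f \<Longrightarrow> f 0 = 0"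
  unfolding linear_between_def using subspace_0[of V] by (metis add_cancel_right_right)

lemma linear_between_sum:
  assumes V: "subspace V" and f: "linear_between scale t V W f"
    and "\<And>i. i \<in> A \<Longrightarrow> g i \<in> V"
  shows "f (\<Sum>i\<in>A. g i) = (\<Sum>i\<in>A. f (g i))"
  using assms(3)
proof (induction A rule: infinite_finite_induct)
  case (insert i A)
  then have "(\<Sum>i\<in>A. g i) \<in> V" by (intro subspace_sum[OF V]) blast
  then show ?case using insert f unfolding linear_between_def by simp
qed (simp_all add: linear_between_zero[OF V f])

text \<open>The ambient space may have infinite dimension; the finiteness of a basis of
  \<open>U\<close> comes from exchange against the finite generating set of
  \<open>V\<close>.\<close>

lemma fin_dim_subspace_mono:
  assumes "fin_dim_subspace scale V" "subspace U" "U \<subseteq> V"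
  shows "fin_dim_subspace scale U"
proof -
  obtain B where B: "B \<subseteq> U" "independent B" "U \<subseteq> span B"
    using maximal_independent_subset by blast
  obtain C where "finite C" "span C = V" using assms(1) unfolding fin_dim_subspace_def by blast
  then have "finite B" using independent_span_bound B assms by (metis subset_trans)
  moreover have "span B = U" using B assms(2) by (simp add: span_subspace)
  ultimately show ?thesis using assms(2) unfolding fin_dim_subspace_def by blast
qed

lemma fin_dim_subspace_basis:
  assumes "fin_dim_subspace scale V"
  obtains B where "finite B" "independent B" "span B = V" "card B = dim V"
proof -
  obtain B where B: "B \<subseteq> V" "independent B" "V \<subseteq> span B" "card B = dim V"
    using basis_exists by blast
  obtain C where "finite C" "span C = V" using assms unfolding fin_dim_subspace_def by blast
  then have "finite B" using independent_span_bound B by metis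
  moreover have "span B = V" using B assms unfolding fin_dim_subspace_def by (simp add: span_subspace)
  ultimately show thesis using B that by blast
qed

lemma dim_mono:
  assumes "fin_dim_subspace scale V" "fin_dim_subspace scale U" "U \<subseteq> V"
  shows "dim U \<le> dim V"
proof -
  obtain B where B: "finite B" "independent B" "span B = V" "card B = dim V"
    using fin_dim_subspace_basis[OF assms(1)] .
  obtain C where C: "finite C" "independent C" "span C = U" "card C = dim U"
    using fin_dim_subspace_basis[OF assms(2)] .
  show ?thesis using independent_span_bound[OF B(1) C(2)] B C assms(3) span_superset by force
qed

text \<open>A vector of \<open>V\<close> outside \<open>U\<close> extends a basis of
  \<open>U\<close> to a larger independent set in \<open>V\<close>.\<close>

lemma dim_strict_mono:
  assumes "fin_dim_subspace scale V" "fin_dim_subspace scale U" "U \<subset> V"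
  shows "dim U < dim V"
proof -
  obtain B where B: "finite B" "independent B" "span B = V" "card B = dim V"
    using fin_dim_subspace_basis[OF assms(1)] .
  obtain C where C: "finite C" "independent C" "span C = U" "card C = dim U"
    using fin_dim_subspace_basis[OF assms(2)] .
  obtain v where v: "v \<in> V" "v \<notin> U" using assms(3) by blast
  then have "independent (insert v C)" "v \<notin> C"
    using C span_base by (auto simp: independent_insert)
  moreover have "insert v C \<subseteq> span B" using v B C assms(3) span_superset[of C] by auto
  ultimately have "card (insert v C) \<le> card B" using independent_span_bound[OF B(1)] by blast
  then show ?thesis using B C \<open>v \<notin> C\<close> by simp
qed

text \<open>The kernel of \<open>f k\<close> contains every other vector of the family, hence their
  span, but not \<open>w k\<close>.\<close>

lemma independent_of_dual_functionals:
  assumes V: "subspace V" and w: "\<And>j. j < m \<Longrightarrow> w j \<in> V"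
    and f: "\<And>i. i < m \<Longrightarrow> linear_between scale (*) V UNIV (f i)"
    and d: "\<And>i j. i < m \<Longrightarrow> j < m \<Longrightarrow> f i (w j) = (if i = j then 1 else 0)"
  shows "independent (w ` {..<m})" "inj_on w {..<m}"
proof -
  show "inj_on w {..<m}"
  proof (rule inj_onI)
    fix i j assume "i \<in> {..<m}" "j \<in> {..<m}" "w i = w j"
    then show "i = j" using d[of i i] d[of i j] by (auto split: if_splits)
  qed
  show "independent (w ` {..<m})"
    unfolding dependent_def
  proof
    assume "\<exists>a\<in>w ` {..<m}. a \<in> span (w ` {..<m} - {a})"
    then obtain k where k: "k < m" "w k \<in> span (w ` {..<m} - {w k})" by auto
    let ?K = "{u \<in> V. f k u = 0}"
    have "subspace ?K"
      using V f[OF k(1)] linear_between_zero[OF V f[OF k(1)]]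
      unfolding subspace_def linear_between_def by auto
    moreover have "w ` {..<m} - {w k} \<subseteq> ?K"
      using w d[OF k(1)] by auto
    ultimately have "w k \<in> ?K" using span_minimal k(2) by blast
    then show False using d[OF k(1) k(1)] by simp
  qed
qed

section \<open>Subrepresentations and direct sums\<close>

lemma is_rep_vspace_subspace:
  "is_rep scale S N \<Longrightarrow> x \<in> Field S \<Longrightarrow> subspace (vspace N x)"
  by (simp add: is_rep_def fin_dim_subspace_def)

lemma is_rep_act_closed:
  "is_rep scale S N \<Longrightarrow> (x, y) \<in> S \<Longrightarrow> u \<in> vspace N x \<Longrightarrow> act N y x u \<in> vspace N y"
  unfolding is_rep_def linear_between_def by blast

lemma is_rep_subrep:
  assumes N: "is_rep scale S N"
    and "\<And>x. x \<in> Field S \<Longrightarrow> subspace (U x)"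
    and sub: "\<And>x. x \<in> Field S \<Longrightarrow> U x \<subseteq> vspace N x"
    and st: "\<And>x y u. (x, y) \<in> S \<Longrightarrow> u \<in> U x \<Longrightarrow> act N y x u \<in> U y"
  shows "is_rep scale S (N\<lparr>vspace := U\<rparr>)"
proof -
  have "linear_between scale scale (U x) (U y) (act N y x)" if "(x, y) \<in> S" for x y
  proof (rule linear_between_mono)
    show "linear_between scale scale (vspace N x) (vspace N y) (act N y x)"
      using N that by (simp add: is_rep_def)
  qed (use that sub st FieldD[OF that] in \<open>auto\<close>)
  moreover have "fin_dim_subspace scale (U x)" if "x \<in> Field S" for x
  proof (rule fin_dim_subspace_mono)
    show "fin_dim_subspace scale (vspace N x)" using N that by (simp add: is_rep_def)
  qed (use that assms in \<open>auto\<close>)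
  moreover have "act N z y (act N y x u) = act N z x u" if "(x, y) \<in> S" "(y, z) \<in> S" "u \<in> U x" for x y z u
    using N that subsetD[OF sub] FieldD[OF that(1)] unfolding is_rep_def by blast
  moreover have "act N x x u = u" if "x \<in> Field S" "u \<in> U x" for x u
    using N that subsetD[OF sub] unfolding is_rep_def by blast
  ultimately show ?thesis unfolding is_rep_def by simp
qed

text \<open>Subtracting two families reduces uniqueness of components to the case of the zero
  vector. The families in \<open>ex\<close> and \<open>ind\<close> are arbitrary functions;
  \<open>restrict\<close> turns them into the extensional ones that the definition quantifies
  over.\<close>

lemma direct_sum_decompI:
  assumes N: "is_rep scale S N"
    and ss: "\<And>i x. i < n \<Longrightarrow> x \<in> Field S \<Longrightarrow> subspace (U i x)"
    and sub: "\<And>i x. i < n \<Longrightarrow> x \<in> Field S \<Longrightarrow> U i x \<subseteq> vspace N x"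
    and st: "\<And>i x y u. i < n \<Longrightarrow> (x, y) \<in> S \<Longrightarrow> u \<in> U i x \<Longrightarrow> act N y x u \<in> U i y"
    and ex: "\<And>x v. x \<in> Field S \<Longrightarrow> v \<in> vspace N x \<Longrightarrow> \<exists>c. (\<forall>i<n. c i \<in> U i x) \<and> v = (\<Sum>i<n. c i)"
    and ind: "\<And>x c i. x \<in> Field S \<Longrightarrow> \<forall>i<n. c i \<in> U i x \<Longrightarrow> (\<Sum>i<n. c i) = 0 \<Longrightarrow> i < n \<Longrightarrow> c i = 0"
  shows "direct_sum_decomp scale S N n U"
  unfolding direct_sum_decomp_def
proof (intro conjI allI impI ballI)
  fix i assume "i < n"
  then show "is_rep scale S (N\<lparr>vspace := U i\<rparr>)"
    using is_rep_subrep[OF N] ss sub st by simp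
  show "\<And>x. x \<in> Field S \<Longrightarrow> U i x \<subseteq> vspace N x" using sub \<open>i < n\<close> by blast
next
  fix x v assume x: "x \<in> Field S" and "v \<in> vspace N x"
  then obtain c where c: "\<forall>i<n. c i \<in> U i x" "v = (\<Sum>i<n. c i)" using ex by blast
  show "\<exists>!c. c \<in> (\<Pi>\<^sub>E i\<in>{..<n}. U i x) \<and> v = (\<Sum>i<n. c i)"
  proof (rule ex1I)
    show "restrict c {..<n} \<in> (\<Pi>\<^sub>E i\<in>{..<n}. U i x) \<and> v = (\<Sum>i<n. restrict c {..<n} i)"
      using c by auto
    fix d assume d: "d \<in> (\<Pi>\<^sub>E i\<in>{..<n}. U i x) \<and> v = (\<Sum>i<n. d i)"
    have "d i - c i = 0" if "i < n" for i
    proof (rule ind[OF x _ _ that])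
      show "\<forall>i<n. d i - c i \<in> U i x" using c d ss[OF _ x] by (auto intro!: subspace_diff)
      show "(\<Sum>i<n. d i - c i) = 0" using c d by (simp add: sum_subtractf)
    qed
    then show "d = restrict c {..<n}" using d by (auto simp: PiE_iff extensional_def fun_eq_iff)
  qed
qed

lemma direct_sum_decompD:
  assumes "direct_sum_decomp scale S N n U"
  shows "i < n \<Longrightarrow> is_rep scale S (N\<lparr>vspace := U i\<rparr>)"
    and "i < n \<Longrightarrow> x \<in> Field S \<Longrightarrow> subspace (U i x)"
    and "i < n \<Longrightarrow> x \<in> Field S \<Longrightarrow> U i x \<subseteq> vspace N x"
    and "i < n \<Longrightarrow> (x, y) \<in> S \<Longrightarrow> u \<in> U i x \<Longrightarrow> act N y x u \<in> U i y"
    and "x \<in> Field S \<Longrightarrow> v \<in> vspace N x \<Longrightarrow> \<exists>c. (\<forall>i<n. c i \<in> U i x) \<and> v = (\<Sum>i<n. c i)"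
    and "is_rep scale S N \<Longrightarrow> x \<in> Field S \<Longrightarrow> \<forall>i<n. c i \<in> U i x \<Longrightarrow> \<forall>i<n. d i \<in> U i x \<Longrightarrow>
      (\<Sum>i<n. c i) = (\<Sum>i<n. d i) \<Longrightarrow> i < n \<Longrightarrow> c i = d i"
proof -
  show rep: "is_rep scale S (N\<lparr>vspace := U i\<rparr>)" if "i < n" for i
    using assms that by (simp add: direct_sum_decomp_def)
  show "i < n \<Longrightarrow> x \<in> Field S \<Longrightarrow> subspace (U i x)" for i x
    using is_rep_vspace_subspace[OF rep] by simp
  show sub: "i < n \<Longrightarrow> x \<in> Field S \<Longrightarrow> U i x \<subseteq> vspace N x" for i x
    using assms by (simp add: direct_sum_decomp_def)
  show "i < n \<Longrightarrow> (x, y) \<in> S \<Longrightarrow> u \<in> U i x \<Longrightarrow> act N y x u \<in> U i y" for x y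
    using is_rep_act_closed[OF rep] by simp
  show "x \<in> Field S \<Longrightarrow> v \<in> vspace N x \<Longrightarrow> \<exists>c. (\<forall>i<n. c i \<in> U i x) \<and> v = (\<Sum>i<n. c i)" for x
    using assms unfolding direct_sum_decomp_def by (metis PiE_mem lessThan_iff)
  assume N: "is_rep scale S N" and x: "x \<in> Field S"
    and c: "\<forall>i<n. c i \<in> U i x" and d: "\<forall>i<n. d i \<in> U i x"
    and eq: "(\<Sum>i<n. c i) = (\<Sum>i<n. d i)" and i: "i < n"
  have "(\<Sum>i<n. c i) \<in> vspace N x"
    using c sub x by (intro subspace_sum is_rep_vspace_subspace[OF N x]) blast
  then have "\<exists>!e. e \<in> (\<Pi>\<^sub>E i\<in>{..<n}. U i x) \<and> (\<Sum>i<n. c i) = (\<Sum>i<n. e i)"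
    using assms x unfolding direct_sum_decomp_def by blast
  moreover have "restrict c {..<n} \<in> (\<Pi>\<^sub>E i\<in>{..<n}. U i x) \<and> (\<Sum>i<n. c i) = (\<Sum>i<n. restrict c {..<n} i)"
    "restrict d {..<n} \<in> (\<Pi>\<^sub>E i\<in>{..<n}. U i x) \<and> (\<Sum>i<n. c i) = (\<Sum>i<n. restrict d {..<n} i)"
    using c d eq by auto
  ultimately have "restrict c {..<n} = restrict d {..<n}" by blast
  then show "c i = d i" using i by (metis lessThan_iff restrict_apply')
qed

lemma direct_sum_decomp_append:
  assumes N: "is_rep scale S N" and U: "direct_sum_decomp scale S N 2 U"
    and A: "direct_sum_decomp scale S (N\<lparr>vspace := U 0\<rparr>) n A"
    and B: "direct_sum_decomp scale S (N\<lparr>vspace := U 1\<rparr>) m B"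
  shows "direct_sum_decomp scale S N (n + m) (\<lambda>i. if i < n then A i else B (i - n))"
    (is "direct_sum_decomp _ _ _ _ ?W")
proof (rule direct_sum_decompI[OF N])
  note U' = direct_sum_decompD[OF U] and A' = direct_sum_decompD[OF A, simplified]
    and B' = direct_sum_decompD[OF B, simplified]
  fix i x assume i: "i < n + m"
  show "subspace (?W i x)" if "x \<in> Field S" using that i A'(2) B'(2) by auto
  show "?W i x \<subseteq> vspace N x" if "x \<in> Field S"
  proof (cases "i < n")
    case True
    then show ?thesis using A'(3)[OF _ that] U'(3)[of 0, OF _ that] by force
  next
    case False
    then show ?thesis using B'(3)[OF _ that, of "i - n"] U'(3)[of 1, OF _ that] i by force
  qed
  show "act N y x u \<in> ?W i y" if "(x, y) \<in> S" "u \<in> ?W i x" for y u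
    using that i A'(4)[of i x y u] B'(4)[of "i - n" x y u] by (auto split: if_splits)
next
  note U' = direct_sum_decompD[OF U] and A' = direct_sum_decompD[OF A, simplified]
    and B' = direct_sum_decompD[OF B, simplified]
  fix x assume x: "x \<in> Field S"
  show "\<exists>c. (\<forall>i<n + m. c i \<in> ?W i x) \<and> v = (\<Sum>i<n + m. c i)" if v: "v \<in> vspace N x" for v
  proof -
    obtain u where u: "\<forall>i<2. u i \<in> U i x" "v = (\<Sum>i<2. u i)" using U'(5)[OF x v] by blast
    then have u2: "u 0 \<in> U 0 x" "u 1 \<in> U 1 x" "v = u 0 + u 1"
      by (auto simp: numeral_2_eq_2)
    obtain a where a: "\<forall>i<n. a i \<in> A i x" "u 0 = (\<Sum>i<n. a i)" using A'(5)[OF x u2(1)] by blast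
    obtain b where b: "\<forall>i<m. b i \<in> B i x" "u 1 = (\<Sum>i<m. b i)"
      using B'(5)[OF x, of "u 1"] u2(2) by auto
    show ?thesis
      by (rule exI[of _ "\<lambda>i. if i < n then a i else b (i - n)"])
        (use a b u2 in \<open>auto simp: sum_lessThan_add\<close>)
  qed
  fix c i assume c: "\<forall>i<n + m. c i \<in> ?W i x" and z: "(\<Sum>i<n + m. c i) = 0" and i: "i < n + m"
  have cA: "c i \<in> A i x" if "i < n" for i using c[rule_format, of i] that by simp
  have cB: "c (n + i) \<in> B i x" if "i < m" for i using c[rule_format, of "n + i"] that by simp
  \<comment> \<open>The block sums form a decomposition of 0 along \<open>U\<close>, so both vanish;
    independence inside each block then gives the claim for the single terms.\<close>
  define u where "u = (\<lambda>j::nat. if j = 0 then \<Sum>i<n. c i else \<Sum>i<m. c (n + i))"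
  have "(\<Sum>i<n. c i) \<in> U 0 x" using cA A'(3)[OF _ x] U'(2)[of 0 x] x by (intro subspace_sum) auto
  moreover have "(\<Sum>i<m. c (n + i)) \<in> U 1 x"
    using cB B'(3)[OF _ x] U'(2)[of 1 x] x by (intro subspace_sum) auto
  ultimately have uU: "\<forall>i<2. u i \<in> U i x" by (auto simp: u_def less_2_cases_iff)
  have z2: "\<forall>i<2. 0 \<in> U i x" using U'(2)[OF _ x] subspace_0 by blast
  have "(\<Sum>i<2. u i) = (\<Sum>i<2::nat. 0)"
    using z by (simp add: u_def sum_lessThan_add numeral_2_eq_2)
  then have u0: "u j = 0" if "j < 2" for j using U'(6)[OF N x uU z2 _ that] by blast
  have "c i = 0" if "i < n" for i
  proof (rule A'(6)[OF _ x, of c "\<lambda>_. 0"])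
    show "is_rep scale S (N\<lparr>vspace := U 0\<rparr>)" using U'(1) by simp
    show "(\<Sum>i<n. c i) = (\<Sum>i<n. 0)" using u0[of 0] by (simp add: u_def)
  qed (use cA that A'(2)[OF _ x] subspace_0 in \<open>auto\<close>)
  moreover have "c (n + i) = 0" if "i < m" for i
  proof (rule B'(6)[OF _ x, of "\<lambda>i. c (n + i)" "\<lambda>_. 0"])
    show "is_rep scale S (N\<lparr>vspace := U (Suc 0)\<rparr>)" using U'(1) by simp
    show "(\<Sum>i<m. c (n + i)) = (\<Sum>i<m. 0)" using u0[of 1] by (simp add: u_def)
  qed (use cB that B'(2)[OF _ x] subspace_0 in \<open>auto\<close>)
  ultimately show "c i = 0" using i by (metis add_less_cancel_left le_add_diff_inverse not_less)
qed

section \<open>Existence of indecomposable decompositions\<close>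

text \<open>Provides the decreasing measure for \<open>indec_decomp_exists\<close>: a nonzero vector
  of \<open>U j\<close> lies outside \<open>U i\<close>, so the dimension drops strictly at one
  point.\<close>

lemma sum_dim_summand_less:
  assumes fin: "finite (Field S)" and N: "is_rep scale S N"
    and U: "direct_sum_decomp scale S N 2 U" and ij: "i < 2" "j < 2" "i \<noteq> j"
    and nz: "\<not> zero_rep S (N\<lparr>vspace := U j\<rparr>)"
  shows "(\<Sum>x\<in>Field S. dim (U i x)) < (\<Sum>x\<in>Field S. dim (vspace N x))"
proof (rule sum_strict_mono_ex1[OF fin])
  note U' = direct_sum_decompD[OF U]
  have fd: "fin_dim_subspace scale (vspace N x)" "fin_dim_subspace scale (U i x)" if "x \<in> Field S" for x
    using N that U'(1)[OF ij(1)] by (auto simp: is_rep_def)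
  show "\<forall>x\<in>Field S. dim (U i x) \<le> dim (vspace N x)"
    using dim_mono[OF fd U'(3)[OF ij(1)]] by blast
  obtain x where x: "x \<in> Field S" "U j x \<noteq> {0}" using nz by (auto simp: zero_rep_def)
  obtain u where u: "u \<in> U j x" "u \<noteq> 0" using x U'(2)[OF ij(2) x(1)] subspace_0 by blast
  have "u \<notin> U i x"
  proof
    assume ui: "u \<in> U i x"
    have "0 \<in> U k x" if "k < 2" for k using U'(2)[OF that x(1)] subspace_0 by blast
    \<comment> \<open>\<open>?c j\<close> and \<open>?c i\<close> put the same vector into two
      different summands; their sums agree, so uniqueness of components would force it to be
      0.\<close>
    let ?c = "\<lambda>j k. if k = j then u else 0"
    have "?c j j = ?c i j"
    proof (rule U'(6)[OF N x(1), of "?c j" "?c i"])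
      show "\<forall>k<2. ?c j k \<in> U k x" "\<forall>k<2. ?c i k \<in> U k x"
        using u ui \<open>\<And>k. k < 2 \<Longrightarrow> 0 \<in> U k x\<close> by auto
      show "(\<Sum>k<2. ?c j k) = (\<Sum>k<2. ?c i k)" using ij by simp
    qed (rule ij)
    then show False using ij u by simp
  qed
  then have "U i x \<subset> vspace N x" using U'(3)[OF ij(1) x(1)] U'(3)[OF ij(2) x(1)] u by blast
  then show "\<exists>x\<in>Field S. dim (U i x) < dim (vspace N x)" using x fd dim_strict_mono by blast
qed

text \<open>Either nothing can be split, or both parts have smaller total dimension and the
  induction hypothesis applies to each.\<close>

lemma indec_decomp_exists:
  assumes fin: "finite (Field S)" and "is_rep scale S N"
  shows "\<exists>n U. indec_decomp scale S N n U"
  using assms(2)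
proof (induction "\<Sum>x\<in>Field S. dim (vspace N x)" arbitrary: N rule: less_induct)
  case (less N)
  note N = \<open>is_rep scale S N\<close>
  consider "zero_rep S N" | "indecomposable scale S N"
    | U where "direct_sum_decomp scale S N 2 U"
      "\<not> zero_rep S (N\<lparr>vspace := U 0\<rparr>)" "\<not> zero_rep S (N\<lparr>vspace := U 1\<rparr>)"
    unfolding indecomposable_def by blast
  then show ?case
  proof cases
    case 1
    \<comment> \<open>The zero representation does not count as indecomposable, so its decomposition
      is the empty one.\<close>
    then have "direct_sum_decomp scale S N 0 (\<lambda>_. vspace N)"
      by (intro direct_sum_decompI[OF N]) (auto simp: zero_rep_def)
    then show ?thesis unfolding indec_decomp_def by blast
  next
    case 2
    have "direct_sum_decomp scale S N 1 (\<lambda>_. vspace N)"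
    proof (rule direct_sum_decompI[OF N])
      show "\<exists>c. (\<forall>i<1::nat. c i \<in> vspace N x) \<and> v = (\<Sum>i<1. c i)" if "v \<in> vspace N x" for x v
        using that by (intro exI[of _ "\<lambda>_. v"]) simp
    qed (use N is_rep_vspace_subspace is_rep_act_closed in \<open>auto\<close>)
    then show ?thesis using 2 unfolding indec_decomp_def by fastforce
  next
    case 3
    note U' = direct_sum_decompD[OF 3(1)]
    obtain n A where A: "indec_decomp scale S (N\<lparr>vspace := U 0\<rparr>) n A"
      using less(1)[of "N\<lparr>vspace := U 0\<rparr>"] sum_dim_summand_less[OF fin N 3(1), of 0 1] 3 U'(1)
      by auto
    obtain m B where B: "indec_decomp scale S (N\<lparr>vspace := U 1\<rparr>) m B"
      using less(1)[of "N\<lparr>vspace := U 1\<rparr>"] sum_dim_summand_less[OF fin N 3(1), of 1 0] 3 U'(1)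
      by auto
    have "direct_sum_decomp scale S N (n + m) (\<lambda>i. if i < n then A i else B (i - n))"
      using direct_sum_decomp_append[OF N 3(1)] A B by (simp add: indec_decomp_def)
    moreover have "indecomposable scale S (N\<lparr>vspace := if i < n then A i else B (i - n)\<rparr>)"
      if "i < n + m" for i using that A B by (auto simp: indec_decomp_def)
    ultimately show ?thesis unfolding indec_decomp_def by blast
  qed
qed


section \<open>Detecting constant summands\<close>

text \<open>The nonzero scalar \<open>l z (v z)\<close> is the same at every point, so the line
  spanned by \<open>v\<close> and the kernel of \<open>l\<close> are complementary
  subrepresentations. Indecomposability makes the kernel vanish, and \<open>l\<close> itself is the
  isomorphism. As \<open>Field Q \<subseteq> I\<close>, the module \<open>interval_module I\<close>
  is constant on \<open>Q\<close>.\<close>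

lemma constant_summand_iso:
  fixes X :: "('p, 'b) rep"
  assumes X: "is_rep scale Q X" and indec: "indecomposable scale Q X" and conn: "connected_poset Q"
    and v: "section_of Q X v" and l: "cosection_of scale Q X l"
    and z: "z \<in> Field Q" "l z (v z) \<noteq> 0" and I: "Field Q \<subseteq> I"
  shows "rep_iso Q scale X (*) (interval_module I)"
proof -
  define c where "c = l z (v z)"
  have c: "c \<noteq> 0" "l x (v x) = c" if "x \<in> Field Q" for x
    using pairing_constant[OF conn v l that z(1)] z(2) by (simp_all add: c_def)
  have lin: "linear_between scale (*) (vspace X x) UNIV (l x)" if "x \<in> Field Q" for x
    using l that by (simp add: cosection_of_def)
  have vX: "v x \<in> vspace X x" if "x \<in> Field Q" for x
    using v that by (simp add: section_of_def)
  note ss = is_rep_vspace_subspace[OF X]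
  have l_scale: "l x (scale r (v x)) = r * c" if "x \<in> Field Q" for x r
    using lin[OF that] vX[OF that] c(2)[OF that] by (simp add: linear_between_def)
  have l_diff: "l x (u - w) = l x u - l x w"
    if "x \<in> Field Q" "u \<in> vspace X x" "w \<in> vspace X x" for x u w
  proof -
    have "l x u = l x ((u - w) + w)" by simp
    also have "\<dots> = l x (u - w) + l x w"
      using lin[OF that(1)] subspace_diff[OF ss[OF that(1)] that(2,3)] that(3)
      unfolding linear_between_def by blast
    finally show ?thesis by simp
  qed
  define U where "U = (\<lambda>i::nat. \<lambda>x. if i = 0 then range (\<lambda>r. scale r (v x))
    else {u \<in> vspace X x. l x u = 0})"
  have "direct_sum_decomp scale Q X 2 U"
  proof (rule direct_sum_decompI[OF X])
    fix i :: nat and x assume i: "i < 2"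
    show "subspace (U i x)" if x: "x \<in> Field Q"
    proof (cases "i = 0")
      case True
      then show ?thesis using span_singleton[of "v x"] subspace_span[of "{v x}"] by (simp add: U_def)
    next
      case False
      have "subspace {u \<in> vspace X x. l x u = 0}"
        using ss[OF x] lin[OF x] linear_between_zero[OF ss[OF x] lin[OF x]]
        unfolding subspace_def linear_between_def by auto
      then show ?thesis using False by (simp add: U_def)
    qed
    show "U i x \<subseteq> vspace X x" if "x \<in> Field Q"
      using vX[OF that] ss[OF that] by (auto simp: U_def subspace_scale)
    show "act X y x u \<in> U i y" if xy: "(x, y) \<in> Q" and u: "u \<in> U i x" for y u
    proof (cases "i = 0")
      case True
      then obtain r where "u = scale r (v x)" using u by (auto simp: U_def)
      then have "act X y x u = scale r (act X y x (v x))"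
        using X xy vX FieldD[OF xy] unfolding is_rep_def linear_between_def by blast
      also have "act X y x (v x) = v y" using v xy by (simp add: section_of_def)
      finally show ?thesis using True by (auto simp: U_def)
    next
      case False
      then show ?thesis
        using u l xy is_rep_act_closed[OF X xy] by (simp add: U_def cosection_of_def)
    qed
  next
    fix x assume x: "x \<in> Field Q"
    show "\<exists>d. (\<forall>i<2. d i \<in> U i x) \<and> u = (\<Sum>i<2. d i)" if u: "u \<in> vspace X x" for u
    proof -
      \<comment> \<open>The projection of \<open>u\<close> to the line along the kernel of
        \<open>l x\<close>; dividing by \<open>c\<close> puts the remainder \<open>u - ?p\<close>
        into that kernel.\<close>
      let ?p = "scale (l x u / c) (v x)"
      have p: "?p \<in> vspace X x" using ss[OF x] vX[OF x] by (simp add: subspace_scale)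
      have "l x (u - ?p) = 0" using l_diff[OF x u p] l_scale[OF x] c(1)[OF x] by simp
      then have "u - ?p \<in> U 1 x" using ss[OF x] u p by (simp add: U_def subspace_diff)
      moreover have "?p \<in> U 0 x" by (auto simp: U_def)
      ultimately show ?thesis
        by (intro exI[of _ "\<lambda>i. if i = 0 then ?p else u - ?p"])
          (auto simp: less_2_cases_iff, simp add: numeral_2_eq_2)
    qed
    fix d :: "nat \<Rightarrow> _" and i :: nat
    assume d: "\<forall>i<2. d i \<in> U i x" and sum: "(\<Sum>i<2. d i) = 0" and i: "i < 2"
    have d01: "d 0 \<in> U 0 x" "d 1 \<in> U 1 x" using d by auto
    have eq: "d 1 = - d 0" using sum by (simp add: numeral_2_eq_2 eq_neg_iff_add_eq_0 add.commute)
    obtain r where r: "d 0 = scale r (v x)" using d01 by (auto simp: U_def)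
    have "d 1 = scale (- r) (v x)" using eq r by simp
    then have "- r * c = 0" using d01(2) l_scale[OF x, of "- r"] by (simp add: U_def)
    then have "d 0 = 0" "d 1 = 0" using r eq c(1)[OF x] by auto
    then show "d i = 0" using i by (auto simp: less_2_cases_iff)
  qed
  then have "zero_rep Q (X\<lparr>vspace := U 0\<rparr>) \<or> zero_rep Q (X\<lparr>vspace := U 1\<rparr>)"
    using indec by (simp add: indecomposable_def)
  moreover have "\<not> zero_rep Q (X\<lparr>vspace := U 0\<rparr>)"
  proof
    assume "zero_rep Q (X\<lparr>vspace := U 0\<rparr>)"
    then have "range (\<lambda>r. scale r (v z)) = {0}" using z(1) by (simp add: zero_rep_def U_def)
    then have "scale 1 (v z) = 0" by blast
    then have "v z = 0" by simp
    then show False using z linear_between_zero[OF ss[OF z(1)] lin[OF z(1)]] by simp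
  qed
  ultimately have "zero_rep Q (X\<lparr>vspace := U 1\<rparr>)" by blast
  then have ker: "{u \<in> vspace X x. l x u = 0} = {0}" if "x \<in> Field Q" for x
    using that by (simp add: zero_rep_def U_def)
  have "bij_betw (l x) (vspace X x) UNIV" if x: "x \<in> Field Q" for x
    unfolding bij_betw_def
  proof
    show "inj_on (l x) (vspace X x)"
    proof (rule inj_onI)
      fix u w assume uw: "u \<in> vspace X x" "w \<in> vspace X x" "l x u = l x w"
      then have "u - w \<in> {u \<in> vspace X x. l x u = 0}"
        using l_diff[OF x] subspace_diff[OF ss[OF x]] by simp
      then show "u = w" using ker[OF x] by simp
    qed
    have "l x (scale (r / c) (v x)) = r" for r using l_scale[OF x] c(1)[OF x] by simp
    moreover have "scale r (v x) \<in> vspace X x" for r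
      using ss[OF x] vX[OF x] by (simp add: subspace_scale)
    ultimately show "l x ` vspace X x = UNIV" by (metis UNIV_eq_I image_eqI)
  qed
  moreover have "vspace (interval_module I :: ('p, 'a) rep) x = UNIV" if "x \<in> Field Q" for x
    using that I by (auto simp: interval_module_def)
  moreover have "act (interval_module I :: ('p, 'a) rep) y x = (\<lambda>u. u)" if "(x, y) \<in> Q" for x y
    using FieldD[OF that] I by (auto simp: interval_module_def fun_eq_iff)
  ultimately show ?thesis
    unfolding rep_iso_def using lin l by (intro exI[of _ l]) (simp add: cosection_of_def)
qed

text \<open>Converse of \<open>constant_summand_iso\<close>: the isomorphism serves as the cosection
  and the preimages of 1 form the section. The last clause records that each space is a line, for
  the dimension count in \<open>dual_system_le_const_summands\<close>.\<close>

lemma rep_iso_interval_moduleE: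
  fixes X :: "('p, 'b) rep"
  assumes X: "is_rep scale Q X" and I: "Field Q \<subseteq> I"
    and iso: "rep_iso Q scale X ((*) :: 'a \<Rightarrow> 'a \<Rightarrow> 'a) (interval_module I)"
  obtains v l where "section_of Q X v" "cosection_of scale Q X l"
    "\<And>x. x \<in> Field Q \<Longrightarrow> l x (v x) = 1"
    "\<And>x u. x \<in> Field Q \<Longrightarrow> u \<in> vspace X x \<Longrightarrow> u = scale (l x u) (v x)"
proof -
  obtain l where l: "\<And>x. x \<in> Field Q \<Longrightarrow> linear_between scale (*) (vspace X x) UNIV (l x)"
    "\<And>x. x \<in> Field Q \<Longrightarrow> bij_betw (l x) (vspace X x) (UNIV :: 'a set)"
    "\<And>x y u. (x, y) \<in> Q \<Longrightarrow> u \<in> vspace X x \<Longrightarrow> l y (act X y x u) = l x u"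
  proof -
    obtain \<phi> where \<phi>: "\<forall>x\<in>Field Q. linear_between scale (*) (vspace X x)
          (vspace (interval_module I :: ('p, 'a) rep) x) (\<phi> x) \<and>
        bij_betw (\<phi> x) (vspace X x) (vspace (interval_module I) x)"
      "\<forall>x y. (x, y) \<in> Q \<longrightarrow> (\<forall>u\<in>vspace X x. \<phi> y (act X y x u) = act (interval_module I) y x (\<phi> x u))"
      using iso unfolding rep_iso_def by blast
    have V: "vspace (interval_module I :: ('p, 'a) rep) x = UNIV" if "x \<in> Field Q" for x
      using that I by (auto simp: interval_module_def)
    have A: "act (interval_module I :: ('p, 'a) rep) y x = (\<lambda>u. u)" if "(x, y) \<in> Q" for x y
      using FieldD[OF that] I by (auto simp: interval_module_def fun_eq_iff)
    show thesis
      by (rule that[of \<phi>]) (use \<phi> V A in \<open>simp_all\<close>)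
  qed
  define v where "v = (\<lambda>x. inv_into (vspace X x) (l x) 1)"
  have v: "v x \<in> vspace X x" "l x (v x) = 1" if "x \<in> Field Q" for x
    using l(2)[OF that] unfolding v_def bij_betw_def by (metis UNIV_I f_inv_into_f inv_into_into)+
  have inj: "u = w" if "x \<in> Field Q" "u \<in> vspace X x" "w \<in> vspace X x" "l x u = l x w" for x u w
    using l(2)[OF that(1)] that unfolding bij_betw_def inj_on_def by blast
  show thesis
  proof (rule that)
    show "section_of Q X v"
      unfolding section_of_def
    proof (intro conjI allI impI ballI v)
      fix x y assume xy: "(x, y) \<in> Q"
      then show "act X y x (v x) = v y"
        using v FieldD[OF xy] l(3)[OF xy] is_rep_act_closed[OF X xy]
        by (intro inj[of y]) auto
    qed
    show "cosection_of scale Q X l" unfolding cosection_of_def using l by blast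
    fix x assume x: "x \<in> Field Q"
    show "l x (v x) = 1" using v x by blast
    fix u assume u: "u \<in> vspace X x"
    show "u = scale (l x u) (v x)"
    proof (rule inj[OF x u])
      show "scale (l x u) (v x) \<in> vspace X x"
        using is_rep_vspace_subspace[OF X x] v[OF x] by (simp add: subspace_scale)
      show "l x u = l x (scale (l x u) (v x))"
        using l(1)[OF x] v[OF x] by (simp add: linear_between_def)
    qed
  qed
qed

section \<open>Multiplicity as the largest size of a dual system\<close>

text \<open>Each constant summand has a section and a cosection pairing to 1. The section is one of
  \<open>N\<close> as well, and the cosection extends to \<open>N\<close> by projecting to the
  summand first, which kills the sections of all other summands.\<close>

lemma dual_system_const_summands:
  fixes N :: "('p, 'b) rep"
  assumes N: "is_rep scale Q N" and D: "direct_sum_decomp scale Q N n U" and I: "Field Q \<subseteq> I"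
  shows "dual_system scale Q N (card {i. i < n \<and>
    rep_iso Q scale (N\<lparr>vspace := U i\<rparr>) ((*) :: 'a \<Rightarrow> 'a \<Rightarrow> 'a) (interval_module I)})"
    (is "dual_system _ _ _ (card ?J)")
proof -
  note D' = direct_sum_decompD[OF D]
  define G where "G = (\<lambda>i v l. section_of Q (N\<lparr>vspace := U i\<rparr>) v \<and>
    cosection_of scale Q (N\<lparr>vspace := U i\<rparr>) l \<and> (\<forall>x\<in>Field Q. l x (v x) = 1))"
  have "\<exists>v l. G i v l" if "i \<in> ?J" for i
  proof -
    have i: "i < n" and iso: "rep_iso Q scale (N\<lparr>vspace := U i\<rparr>) ((*) :: 'a \<Rightarrow> 'a \<Rightarrow> 'a) (interval_module I)"
      using that by auto
    show ?thesis
      unfolding G_def by (rule rep_iso_interval_moduleE[OF D'(1)[OF i] I iso]) (intro exI conjI ballI)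
  qed
  then have "\<forall>i\<in>?J. \<exists>v l. G i v l" by (rule ballI)
  then obtain v l where vl: "\<forall>i\<in>?J. G i (v i) (l i)" unfolding bchoice_iff by (elim exE) (rule that)
  note vl = vl[rule_format, unfolded G_def]
  note v = vl[THEN conjunct1] and l = vl[THEN conjunct2, THEN conjunct1]
    and lv = vl[THEN conjunct2, THEN conjunct2, rule_format]
  define pr where "pr = (\<lambda>x u. SOME c. (\<forall>i<n. c i \<in> U i x) \<and> u = (\<Sum>i<n. c i))"
  have pr: "\<And>i. i < n \<Longrightarrow> pr x u i \<in> U i x" "u = (\<Sum>i<n. pr x u i)"
    if "x \<in> Field Q" "u \<in> vspace N x" for x u
    using someI_ex[OF D'(5)[OF that]] unfolding pr_def by blast+
  \<comment> \<open>Any decomposition of \<open>u\<close> found by other means is the chosen one.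
    Additivity, homogeneity and naturality of the projections all follow from this.\<close>
  have pr_eq: "pr x u i = c i"
    if "x \<in> Field Q" "u \<in> vspace N x" "\<forall>i<n. c i \<in> U i x" "u = (\<Sum>i<n. c i)" "i < n" for x u c i
    using D'(6)[OF N that(1) _ that(3) _ that(5), of "pr x u"] pr[OF that(1,2)] that(4) by auto
  define L where "L = (\<lambda>i x u. l i x (pr x u i))"
  have sec: "section_of Q N (v i)" if "i \<in> ?J" for i
    using v[OF that] D'(3)[of i] that by (auto simp: section_of_def)
  have cos: "cosection_of scale Q N (L i)" if i: "i \<in> ?J" for i
    unfolding cosection_of_def
  proof (intro conjI ballI allI impI)
    fix x assume x: "x \<in> Field Q"
    note ss = is_rep_vspace_subspace[OF N x] and ssU = D'(2)[OF _ x]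
    have lin: "linear_between scale (*) (U i x) UNIV (l i x)"
      using l[OF i] x by (simp add: cosection_of_def)
    have add: "pr x (u + w) i = pr x u i + pr x w i"
      if u: "u \<in> vspace N x" and w: "w \<in> vspace N x" for u w
      using pr[OF x u] pr[OF x w] ss u w ssU i
      by (intro pr_eq[OF x, where c = "\<lambda>i. pr x u i + pr x w i"])
        (auto simp: subspace_add sum.distrib)
    have scl: "pr x (scale r u) i = scale r (pr x u i)" if u: "u \<in> vspace N x" for r u
    proof (rule pr_eq[OF x, where c = "\<lambda>i. scale r (pr x u i)"])
      show "scale r u = (\<Sum>i<n. scale r (pr x u i))"
        using pr(2)[OF x u] by (metis scale_sum_right)
    qed (use pr(1)[OF x u] ss u ssU i in \<open>auto simp: subspace_scale\<close>)
    show "linear_between scale (*) (vspace N x) UNIV (L i x)"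
      unfolding linear_between_def L_def
      using lin pr(1)[OF x] i by (simp add: add scl linear_between_def)
  next
    fix x y u assume xy: "(x, y) \<in> Q" and u: "u \<in> vspace N x"
    note F = FieldD[OF xy]
    have p: "\<And>j. j < n \<Longrightarrow> pr x u j \<in> U j x" "u = (\<Sum>j<n. pr x u j)" using pr F u by blast+
    have "act N y x u = (\<Sum>j<n. act N y x (pr x u j))"
      unfolding p(2)[symmetric]
      using linear_between_sum[of "vspace N x" scale "vspace N y" "act N y x" "{..<n}" "pr x u"]
        N xy F D'(3) p is_rep_vspace_subspace[OF N] unfolding is_rep_def by (auto simp: subset_iff)
    then have "pr y (act N y x u) i = act N y x (pr x u i)"
      using D'(4)[OF _ xy] p(1) F is_rep_act_closed[OF N xy u] i
      by (intro pr_eq[where c = "\<lambda>j. act N y x (pr x u j)"]) auto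
    then show "L i y (act N y x u) = L i x u"
      using l[OF i] xy p(1) i by (simp add: L_def cosection_of_def)
  qed
  have dual: "L i x (v j x) = (if i = j then 1 else 0)"
    if i: "i \<in> ?J" and j: "j \<in> ?J" and x: "x \<in> Field Q" for i j x
  proof -
    have vj: "v j x \<in> U j x" using v[OF j] x by (simp add: section_of_def)
    have "pr x (v j x) i = (if i = j then v j x else 0)"
      using vj j i D'(3)[OF _ x] D'(2)[OF _ x] subspace_0
      by (intro pr_eq[OF x, where c = "\<lambda>i. if i = j then v j x else 0"]) auto
    moreover have "l i x 0 = 0"
      using linear_between_zero[OF D'(2)[OF _ x], of i "(*)" UNIV "l i x"] l[OF i] i x
      by (simp add: cosection_of_def)
    ultimately show ?thesis using lv[OF i x] by (auto simp: L_def)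
  qed
  have "finite ?J" by simp
  \<comment> \<open>\<open>dual_system\<close> is indexed by an initial segment, so the set of
    constant summands is renumbered.\<close>
  then obtain h where h: "bij_betw h {..<card ?J} ?J"
    using ex_bij_betw_nat_finite[of ?J] by (auto simp: atLeast0LessThan)
  have hJ: "h i \<in> ?J" if "i < card ?J" for i using h that unfolding bij_betw_def by blast
  have "h i = h j \<longleftrightarrow> i = j" if "i < card ?J" "j < card ?J" for i j
    using h that unfolding bij_betw_def inj_on_def by blast
  then show ?thesis
    unfolding dual_system_def
    using sec[OF hJ] cos[OF hJ] dual[OF hJ hJ]
    by (intro exI[of _ "\<lambda>i. v (h i)"] exI[of _ "\<lambda>i. L (h i)"]) simp
qed

text \<open>By \<open>constant_summand_iso\<close>, the component of a section in a non-constant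
  summand pairs to 0 with every cosection. Dropping these components keeps the system dual, so at a
  fixed point the remaining vectors are independent; they lie in a sum of as many lines as there are
  constant summands.\<close>

lemma dual_system_le_const_summands:
  fixes N :: "('p, 'b) rep"
  assumes N: "is_rep scale Q N" and ID: "indec_decomp scale Q N n U" and I: "Field Q \<subseteq> I"
    and conn: "connected_poset Q" and dual: "dual_system scale Q N m"
  shows "m \<le> card {i. i < n \<and>
    rep_iso Q scale (N\<lparr>vspace := U i\<rparr>) ((*) :: 'a \<Rightarrow> 'a \<Rightarrow> 'a) (interval_module I)}"
    (is "_ \<le> card ?J")
proof -
  have D: "direct_sum_decomp scale Q N n U" using ID by (simp add: indec_decomp_def)
  note D' = direct_sum_decompD[OF D]
  obtain v l where v: "\<And>i. i < m \<Longrightarrow> section_of Q N (v i)"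
    and l: "\<And>i. i < m \<Longrightarrow> cosection_of scale Q N (l i)"
    and lv: "\<And>i j x. i < m \<Longrightarrow> j < m \<Longrightarrow> x \<in> Field Q \<Longrightarrow> l i x (v j x) = (if i = j then 1 else 0)"
    using dual unfolding dual_system_def by blast
  have vN: "v j x \<in> vspace N x" if "j < m" "x \<in> Field Q" for j x
    using v[OF that(1)] that(2) by (simp add: section_of_def)
  have "\<exists>c. (\<forall>i<n. c i \<in> U i x) \<and> v j x = (\<Sum>i<n. c i)" if "j < m" "x \<in> Field Q" for j x
    using D'(5)[OF that(2) vN[OF that]] .
  then obtain c where c: "\<And>j x i. j < m \<Longrightarrow> x \<in> Field Q \<Longrightarrow> i < n \<Longrightarrow> c j x i \<in> U i x"
    "\<And>j x. j < m \<Longrightarrow> x \<in> Field Q \<Longrightarrow> v j x = (\<Sum>i<n. c j x i)"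
    by metis
  \<comment> \<open>The structure maps preserve the summands, so by uniqueness of components each
    component of a section is a section of its summand.\<close>
  have csec: "section_of Q (N\<lparr>vspace := U i\<rparr>) (\<lambda>x. c j x i)" if j: "j < m" and i: "i < n" for i j
    unfolding section_of_def
  proof (intro conjI allI impI ballI)
    fix x y assume xy: "(x, y) \<in> Q"
    note F = FieldD[OF xy]
    have "act N y x (\<Sum>i<n. c j x i) = (\<Sum>i<n. act N y x (c j x i))"
      using linear_between_sum[of "vspace N x" scale "vspace N y" "act N y x" "{..<n}" "c j x"]
        N xy F D'(3) c(1)[OF j] is_rep_vspace_subspace[OF N] unfolding is_rep_def by (auto simp: subset_iff)
    moreover have "act N y x (v j x) = v j y" using v[OF j] xy by (simp add: section_of_def)
    ultimately have "(\<Sum>i<n. act N y x (c j x i)) = (\<Sum>i<n. c j y i)"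
      using c(2)[OF j] F by simp
    then have "act N y x (c j x i) = c j y i"
      using D'(6)[OF N, of y "\<lambda>i. act N y x (c j x i)" "c j y" i] F D'(4)[OF _ xy] c(1)[OF j] i by simp
    then show "act (N\<lparr>vspace := U i\<rparr>) y x (c j x i) = c j y i" by simp
  qed (use c(1) j i in \<open>simp\<close>)
  have lcos: "cosection_of scale Q (N\<lparr>vspace := U i\<rparr>) (l k)" if "k < m" "i < n" for i k
    using cosection_of_subrep[OF l[OF that(1)] D'(3)[OF that(2)]] .
  have zero: "l k x (c j x i) = 0"
    if "k < m" "j < m" "i < n" "i \<notin> ?J" "x \<in> Field Q" for i j k x
  proof (rule ccontr)
    assume "l k x (c j x i) \<noteq> 0"
    moreover have "indecomposable scale Q (N\<lparr>vspace := U i\<rparr>)"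
      using ID that by (simp add: indec_decomp_def)
    ultimately have "rep_iso Q scale (N\<lparr>vspace := U i\<rparr>) ((*) :: 'a \<Rightarrow> 'a \<Rightarrow> 'a) (interval_module I)"
      by (intro constant_summand_iso[OF D'(1)[OF that(3)] _ conn csec[OF that(2,3)]
        lcos[OF that(1,3)] that(5) _ I])
    then show False using that by simp
  qed
  \<comment> \<open>From here on the count takes place in the single vector space at
    \<open>x\<close>.\<close>
  obtain x where x: "x \<in> Field Q" using conn FieldD unfolding connected_poset_def by fast
  have "\<exists>e. U i x \<subseteq> span {e}" if "i \<in> ?J" for i
  proof -
    have i: "i < n" and iso: "rep_iso Q scale (N\<lparr>vspace := U i\<rparr>) ((*) :: 'a \<Rightarrow> 'a \<Rightarrow> 'a) (interval_module I)"
      using that by auto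
    show ?thesis
    proof (rule rep_iso_interval_moduleE[OF D'(1)[OF i] I iso])
      fix e f
      assume ef: "\<And>x u. x \<in> Field Q \<Longrightarrow> u \<in> vspace (N\<lparr>vspace := U i\<rparr>) x \<Longrightarrow> u = scale (f x u) (e x)"
      have "u \<in> span {e x}" if "u \<in> U i x" for u
        using ef[OF x, of u] that span_scale[OF span_base, of "e x" "{e x}" "f x u"] by simp
      then show ?thesis by blast
    qed
  qed
  then have "\<forall>i\<in>?J. \<exists>e. U i x \<subseteq> span {e}" by (rule ballI)
  then obtain e where e: "\<forall>i\<in>?J. U i x \<subseteq> span {e i}" unfolding bchoice_iff by (rule exE)
  \<comment> \<open>The part of \<open>v j x\<close> in the constant summands. By
    \<open>zero\<close>, the omitted components do not change the value of any
    \<open>l k x\<close>.\<close>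
  define w where "w = (\<lambda>j. \<Sum>i\<in>?J. c j x i)"
  note ss = is_rep_vspace_subspace[OF N x]
  have cN: "c j x i \<in> vspace N x" if "j < m" "i < n" for i j
    using c(1)[OF that(1) x that(2)] D'(3)[OF that(2) x] by blast
  have wN: "w j \<in> vspace N x" if "j < m" for j
    unfolding w_def using cN[OF that] by (intro subspace_sum ss) auto
  have lin: "linear_between scale (*) (vspace N x) UNIV (l k x)" if "k < m" for k
    using l[OF that] x by (simp add: cosection_of_def)
  have "l k x (w j) = (if k = j then 1 else 0)" if k: "k < m" and j: "j < m" for k j
  proof -
    have "l k x (w j) = (\<Sum>i\<in>?J. l k x (c j x i))"
      unfolding w_def using cN[OF j] by (intro linear_between_sum[OF ss lin[OF k]]) simp
    also have "\<dots> = (\<Sum>i<n. l k x (c j x i))"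
      using zero[OF k j] x by (intro sum.mono_neutral_left) auto
    also have "\<dots> = l k x (v j x)"
      using linear_between_sum[OF ss lin[OF k], of "{..<n}" "c j x"] cN[OF j] c(2)[OF j x] by simp
    finally show ?thesis using lv[OF k j x] by simp
  qed
  then have ind: "independent (w ` {..<m})" "inj_on w {..<m}"
    using independent_of_dual_functionals[where V = "vspace N x" and w = w and m = m and f = "\<lambda>k. l k x"]
      ss wN lin by blast+
  have "w j \<in> span (e ` ?J)" if "j < m" for j
    unfolding w_def
  proof (rule span_sum)
    fix i assume i: "i \<in> ?J"
    then have "c j x i \<in> span {e i}" using c(1)[OF that x] e i by auto
    then show "c j x i \<in> span (e ` ?J)" using i span_mono[of "{e i}" "e ` ?J"] by blast
  qed
  then have "card (w ` {..<m}) \<le> card (e ` ?J)"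
    using independent_span_bound[OF _ ind(1), of "e ` ?J"] by auto
  also have "\<dots> \<le> card ?J" by (rule card_image_le) simp
  finally show ?thesis using ind(2) by (simp add: card_image)
qed

text \<open>The two bounds show that the count of constant summands in any indecomposable
  decomposition is the greatest size of a dual system, an expression that mentions no decomposition.
  Hence the \<open>THE\<close> in \<open>multiplicity_in\<close> denotes: existence is
  \<open>indec_decomp_exists\<close>, and uniqueness is this instance of the Krull-Schmidt
  theorem.\<close>

lemma multiplicity_in_interval_module:
  fixes N :: "('p, 'b) rep"
  assumes N: "is_rep scale Q N" and fin: "finite (Field Q)"
    and conn: "connected_poset Q" and I: "Field Q \<subseteq> I"
  shows "multiplicity_in Q ((*) :: 'a \<Rightarrow> 'a \<Rightarrow> 'a) (interval_module I) scale N =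
    (GREATEST m. dual_system scale Q N m)"
proof -
  have G: "(GREATEST m. dual_system scale Q N m) =
      card {i. i < n \<and> rep_iso Q scale (N\<lparr>vspace := U i\<rparr>) ((*) :: 'a \<Rightarrow> 'a \<Rightarrow> 'a) (interval_module I)}"
    if U: "indec_decomp scale Q N n U" for n U
  proof (rule Greatest_equality)
    show "dual_system scale Q N (card {i. i < n \<and>
        rep_iso Q scale (N\<lparr>vspace := U i\<rparr>) ((*) :: 'a \<Rightarrow> 'a \<Rightarrow> 'a) (interval_module I)})"
      using U dual_system_const_summands[OF N _ I] by (simp add: indec_decomp_def)
  qed (rule dual_system_le_const_summands[OF N U I conn])
  obtain n U where U: "indec_decomp scale Q N n U" using indec_decomp_exists[OF fin N] by blast
  show ?thesis
    unfolding multiplicity_in_def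
  proof (rule the_equality)
    show "\<exists>n U. indec_decomp scale Q N n U \<and> (GREATEST m. dual_system scale Q N m) =
        card {i. i < n \<and> rep_iso Q scale (N\<lparr>vspace := U i\<rparr>) (*) (interval_module I)}"
      using U G[OF U] by (intro exI conjI)
  qed (elim exE conjE, simp only: G)
qed

end

section \<open>The zigzag poset of a grid interval\<close>

text \<open>Along the list first coordinates increase and second coordinates decrease, so
  \<open>z\<close> dominates the first ones through entry \<open>j\<close> and the second ones
  through entry \<open>i\<close>. The join at \<open>k\<close> takes its first coordinate from entry
  \<open>Suc k\<close>, hence the bound \<open>k < j\<close>.\<close>

lemma zz_a_le_between:
  assumes I: "interval (grid p q) I" and ij: "i \<le> j" "j < length (zz_a (grid p q) I)"
    and z: "(zz_a (grid p q) I ! i, z) \<in> grid p q" "(zz_a (grid p q) I ! j, z) \<in> grid p q"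
    and k: "i \<le> k"
  shows "k \<le> j \<Longrightarrow> (zz_a (grid p q) I ! k, z) \<in> grid p q"
    and "k < j \<Longrightarrow> (zz_join (grid p q) I k, z) \<in> grid p q"
proof -
  let ?as = "zz_a (grid p q) I"
  have sub: "I \<subseteq> Field (grid p q)" using I by (simp add: interval_def)
  note srt = zz_lists(2)[OF sub]
  have G: "?as ! k \<in> Field (grid p q)" if "k \<le> j" for k
    using nth_mem[of k ?as] ij that sub zz_lists(1)[OF sub] by (auto simp: sc_def)
  have f: "fst (?as ! k) \<le> fst z" if "k \<le> j" for k
    using sorted_fst_le[OF srt that ij(2)] z(2) by (simp add: grid_iff)
  have s: "snd (?as ! k) \<le> snd z" if "k \<le> j" "i \<le> k" for k
    using zz_a_snd_less[OF sub, of i k] that ij z(1) by (cases "i = k") (auto simp: grid_iff)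
  show "(?as ! k, z) \<in> grid p q" if "k \<le> j"
    using G[OF that] f[OF that] s[OF that k] z(1) by (simp add: grid_iff Field_grid)
  show "(zz_join (grid p q) I k, z) \<in> grid p q" if "k < j"
    using G[of k] G[of "Suc k"] f[of "Suc k"] s[of k] that k ij z(1)
    by (simp add: zz_join_eq(1)[OF I] grid_iff Field_grid mem_Times_iff)
qed

text \<open>Order dual of \<open>zz_a_le_between\<close>: entry \<open>i\<close> now controls the
  first coordinates and entry \<open>j\<close> the second ones, and the meet at \<open>k\<close>
  takes its second coordinate from entry \<open>Suc k\<close>.\<close>

lemma zz_b_ge_between:
  assumes I: "interval (grid p q) I" and ij: "i \<le> j" "j < length (zz_b (grid p q) I)"
    and z: "(z, zz_b (grid p q) I ! i) \<in> grid p q" "(z, zz_b (grid p q) I ! j) \<in> grid p q"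
    and k: "i \<le> k"
  shows "k \<le> j \<Longrightarrow> (z, zz_b (grid p q) I ! k) \<in> grid p q"
    and "k < j \<Longrightarrow> (z, zz_meet (grid p q) I k) \<in> grid p q"
proof -
  let ?bs = "zz_b (grid p q) I"
  have sub: "I \<subseteq> Field (grid p q)" using I by (simp add: interval_def)
  note srt = zz_lists(4)[OF sub]
  have G: "?bs ! k \<in> Field (grid p q)" if "k \<le> j" for k
    using nth_mem[of k ?bs] ij that sub zz_lists(3)[OF sub] by (auto simp: sk_def)
  have f: "fst z \<le> fst (?bs ! k)" if "k \<le> j" "i \<le> k" for k
    using sorted_fst_le[OF srt that(2)] z(1) that ij by (force simp: grid_iff)
  have s: "snd z \<le> snd (?bs ! k)" if "k \<le> j" for k
    using zz_b_snd_less[OF sub, of k j] that ij z(2) by (cases "k = j") (auto simp: grid_iff)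
  show "(z, ?bs ! k) \<in> grid p q" if "k \<le> j"
    using G[OF that] f[OF that k] s[OF that] z(1) by (simp add: grid_iff Field_grid)
  show "(z, zz_meet (grid p q) I k) \<in> grid p q" if "k < j"
    using G[of k] G[of "Suc k"] f[of k] s[of "Suc k"] that k ij z(1)
    by (simp add: zz_meet_eq(1)[OF I] grid_iff Field_grid mem_Times_iff)
qed

text \<open>Collects the properties of the zigzag poset so that the extension proofs need not unfold
  \<open>zz\<close>.\<close>

lemma zz_relations:
  assumes "interval (grid p q) I"
  defines "Q \<equiv> fst (zz (grid p q) I)"
  shows "Q \<subseteq> Restr (grid p q) I" and "finite (Field Q)" and "connected_poset Q" and "Field Q \<subseteq> I"
    and "i < length (zz_a (grid p q) I) \<Longrightarrow> zz_a (grid p q) I ! i \<in> Field Q"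
    and "i < length (zz_b (grid p q) I) \<Longrightarrow> zz_b (grid p q) I ! i \<in> Field Q"
    and "Suc i < length (zz_a (grid p q) I) \<Longrightarrow> (zz_a (grid p q) I ! i, zz_join (grid p q) I i) \<in> Q"
    and "Suc i < length (zz_a (grid p q) I) \<Longrightarrow> (zz_a (grid p q) I ! Suc i, zz_join (grid p q) I i) \<in> Q"
    and "Suc i < length (zz_b (grid p q) I) \<Longrightarrow> (zz_meet (grid p q) I i, zz_b (grid p q) I ! i) \<in> Q"
    and "Suc i < length (zz_b (grid p q) I) \<Longrightarrow> (zz_meet (grid p q) I i, zz_b (grid p q) I ! Suc i) \<in> Q"
    and "(zz_a (grid p q) I ! 0, zz_b (grid p q) I ! 0) \<in> Q"
proof -
  have sub: "I \<subseteq> Field (grid p q)" using assms(1) by (simp add: interval_def)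
  have zz_eq: "zz (grid p q) I = (Q, \<lambda>x. x)" by (simp add: Q_def zz_def)
  have "compression_system (grid p q) (zz (grid p q))"
    using rank_compression_system_zz unfolding rank_compression_system_def by (rule conjunct1)
  note this[unfolded compression_system_def, rule_format, OF assms(1), unfolded zz_eq prod.case image_ident]
  then have comp: "finite (Field Q) \<and> connected_poset Q \<and>
      (\<forall>x y. (x, y) \<in> Q \<longrightarrow> (x, y) \<in> grid p q) \<and>
      Field Q \<subseteq> I \<and> sc (grid p q) I \<union> sk (grid p q) I \<subseteq> Field Q"
    by (rule conjunct2)
  note comp' = comp[THEN conjunct2, THEN conjunct2]
  note QP = comp'[THEN conjunct1, rule_format] and QI = comp'[THEN conjunct2, THEN conjunct1]
    and carrier = comp'[THEN conjunct2, THEN conjunct2]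
  show "finite (Field Q)" by (rule comp[THEN conjunct1])
  show "connected_poset Q" by (rule comp[THEN conjunct2, THEN conjunct1])
  show "Field Q \<subseteq> I" by (rule QI)
  show "Q \<subseteq> Restr (grid p q) I"
  proof (rule subrelI)
    fix x y assume xy: "(x, y) \<in> Q"
    then show "(x, y) \<in> Restr (grid p q) I"
      using QP[OF xy] subsetD[OF QI FieldI1[OF xy]] subsetD[OF QI FieldI2[OF xy]] by simp
  qed
  show "i < length (zz_a (grid p q) I) \<Longrightarrow> zz_a (grid p q) I ! i \<in> Field Q"
    "i < length (zz_b (grid p q) I) \<Longrightarrow> zz_b (grid p q) I ! i \<in> Field Q"
    using carrier zz_lists(1,3)[OF sub] nth_mem by blast+
  have "zz_gen (grid p q) I \<subseteq> Q" unfolding Q_def zz_def by auto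
  then show "Suc i < length (zz_a (grid p q) I) \<Longrightarrow> (zz_a (grid p q) I ! i, zz_join (grid p q) I i) \<in> Q"
    "Suc i < length (zz_a (grid p q) I) \<Longrightarrow> (zz_a (grid p q) I ! Suc i, zz_join (grid p q) I i) \<in> Q"
    "Suc i < length (zz_b (grid p q) I) \<Longrightarrow> (zz_meet (grid p q) I i, zz_b (grid p q) I ! i) \<in> Q"
    "Suc i < length (zz_b (grid p q) I) \<Longrightarrow> (zz_meet (grid p q) I i, zz_b (grid p q) I ! Suc i) \<in> Q"
    "(zz_a (grid p q) I ! 0, zz_b (grid p q) I ! 0) \<in> Q"
    unfolding zz_gen_def by auto
qed

lemma is_repD:
  assumes "is_rep s P M"
  shows "(x, y) \<in> P \<Longrightarrow> linear_between s s (vspace M x) (vspace M y) (act M y x)"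
    and "(x, y) \<in> P \<Longrightarrow> u \<in> vspace M x \<Longrightarrow> act M y x u \<in> vspace M y"
    and "x \<in> Field P \<Longrightarrow> u \<in> vspace M x \<Longrightarrow> act M x x u = u"
    and "(x, y) \<in> P \<Longrightarrow> (y, z) \<in> P \<Longrightarrow> u \<in> vspace M x \<Longrightarrow> act M z y (act M y x u) = act M z x u"
  using assms unfolding is_rep_def linear_between_def by blast+

section \<open>Extension from the zigzag poset to the interval\<close>

text \<open>The value at \<open>z\<close> is pushed up from any minimal element below
  \<open>z\<close>; linking joins below \<open>z\<close> make the result independent of the choice.
  Agreement is recorded at the first minimal element, the lower end of the relation that links the
  minimal to the maximal elements.\<close>

lemma section_zz_extends:
  assumes M: "is_rep s (grid p q) M" and I: "interval (grid p q) I"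
    and v: "section_of (fst (zz (grid p q) I)) M v"
  obtains v' where "section_of (Restr (grid p q) I) M v'"
    "v' (zz_a (grid p q) I ! 0) = v (zz_a (grid p q) I ! 0)"
proof -
  let ?P = "grid p q" and ?as = "zz_a (grid p q) I"
  have sub: "I \<subseteq> Field ?P" using I by (simp add: interval_def)
  note zz = zz_relations[OF I]
  have QP: "(x, y) \<in> ?P" if "(x, y) \<in> fst (zz ?P I)" for x y using that zz(1) by blast
  note vM = section_ofD(1)[OF v] and vQ = section_ofD(2)[OF v]
  define w where "w = (\<lambda>i z. act M z (?as ! i) (v (?as ! i)))"
  \<comment> \<open>Both values factor through the join, where the section \<open>v\<close> has a
    single value.\<close>
  have adjacent: "w k z = w (Suc k) z"
    if k: "Suc k < length ?as" and z: "(zz_join ?P I k, z) \<in> ?P" for k z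
  proof -
    have "w l z = act M z (zz_join ?P I k) (v (zz_join ?P I k))"
      if l: "l < length ?as" "(?as ! l, zz_join ?P I k) \<in> fst (zz ?P I)" for l
      using is_repD(4)[OF M QP[OF l(2)] z vM[OF zz(5)[OF l(1)]]] vQ[OF l(2)] by (simp add: w_def)
    then show ?thesis using zz(7,8)[OF k] k by simp
  qed
  have chain: "w i z = w j z"
    if ij: "i \<le> j" "j < length ?as" and z: "(?as ! i, z) \<in> ?P" "(?as ! j, z) \<in> ?P" for i j z
  proof -
    \<comment> \<open>Moving one entry at a time stays within reach of \<open>adjacent\<close>,
      since every join between \<open>i\<close> and \<open>j\<close> lies below
      \<open>z\<close>.\<close>
    have "w i z = w k z" if "i \<le> k" "k \<le> j" for k
      using that
    proof (induction k rule: dec_induct)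
      case (step k)
      then show ?case
        using adjacent[of k z] zz_a_le_between(2)[OF I ij z, of k] ij by simp
    qed simp
    then show ?thesis using ij by simp
  qed
  have indep: "w i z = w j z"
    if "i < length ?as" "j < length ?as" "(?as ! i, z) \<in> ?P" "(?as ! j, z) \<in> ?P" for i j z
  proof (cases "i \<le> j")
    case True
    then show ?thesis by (rule chain[OF _ that(2-4)])
  next
    case False
    then show ?thesis by (intro chain[OF _ that(1,4,3), symmetric]) simp
  qed
  \<comment> \<open>Some minimal element below \<open>z\<close>; by \<open>indep\<close> the value
    at \<open>z\<close> does not depend on which.\<close>
  define idx where "idx = (\<lambda>z. SOME i. i < length ?as \<and> (?as ! i, z) \<in> ?P)"
  have idx: "idx z < length ?as" "(?as ! idx z, z) \<in> ?P" if z: "z \<in> I" for z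
  proof -
    obtain a where "a \<in> sc ?P I" "(a, z) \<in> ?P" using sc_below[OF sub z] .
    then have "\<exists>i. i < length ?as \<and> (?as ! i, z) \<in> ?P"
      using zz_lists(1)[OF sub] by (metis in_set_conv_nth)
    from someI_ex[OF this] show "idx z < length ?as" "(?as ! idx z, z) \<in> ?P"
      by (simp_all add: idx_def)
  qed
  have a0: "0 < length ?as" using zz_lists_nonempty(1)[OF I] by simp
  show thesis
  proof (rule that)
    show "section_of (Restr ?P I) M (\<lambda>z. w (idx z) z)"
      unfolding section_of_def Field_Restr_grid[OF sub]
    proof (intro conjI ballI allI impI)
      fix z assume z: "z \<in> I"
      show "w (idx z) z \<in> vspace M z"
        unfolding w_def by (rule is_repD(2)[OF M idx(2)[OF z] vM[OF zz(5)[OF idx(1)[OF z]]]])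
    next
      fix x y assume "(x, y) \<in> Restr ?P I"
      then have xy: "(x, y) \<in> ?P" and x: "x \<in> I" and y: "y \<in> I" by blast+
      have "act M y x (w (idx x) x) = w (idx x) y"
        unfolding w_def by (rule is_repD(4)[OF M idx(2)[OF x] xy vM[OF zz(5)[OF idx(1)[OF x]]]])
      also have "\<dots> = w (idx y) y"
        by (rule indep[OF idx(1)[OF x] idx(1)[OF y] grid_trans[OF idx(2)[OF x] xy] idx(2)[OF y]])
      finally show "act M y x (w (idx x) x) = w (idx y) y" .
    qed
    have aI: "?as ! 0 \<in> I" by (rule subsetD[OF zz(4) zz(5)[OF a0]])
    have "w (idx (?as ! 0)) (?as ! 0) = w 0 (?as ! 0)"
      by (rule indep[OF idx(1)[OF aI] a0 idx(2)[OF aI] grid_refl[OF subsetD[OF sub aI]]])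
    also have "\<dots> = v (?as ! 0)"
      unfolding w_def by (rule is_repD(3)[OF M subsetD[OF sub aI] vM[OF zz(5)[OF a0]]])
    finally show "w (idx (?as ! 0)) (?as ! 0) = v (?as ! 0)" .
  qed
qed

text \<open>Order dual of \<open>section_zz_extends\<close>: a vector at \<open>z\<close> is pushed
  to a maximal element above \<open>z\<close> and evaluated there, with meets in place of joins.
  Agreement is claimed only on the space of \<open>M\<close>, because a cosection is unconstrained
  elsewhere.\<close>

lemma cosection_zz_extends:
  assumes M: "is_rep s (grid p q) M" and I: "interval (grid p q) I"
    and l: "cosection_of s (fst (zz (grid p q) I)) M l"
  obtains l' where "cosection_of s (Restr (grid p q) I) M l'"
    "\<And>u. u \<in> vspace M (zz_b (grid p q) I ! 0) \<Longrightarrow>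
      l' (zz_b (grid p q) I ! 0) u = l (zz_b (grid p q) I ! 0) u"
proof -
  let ?P = "grid p q" and ?bs = "zz_b (grid p q) I"
  have sub: "I \<subseteq> Field ?P" using I by (simp add: interval_def)
  note zz = zz_relations[OF I]
  have QP: "(x, y) \<in> ?P" if "(x, y) \<in> fst (zz ?P I)" for x y using that zz(1) by blast
  note lin = cosection_ofD(1)[OF l] and lQ = cosection_ofD(2)[OF l]
  define w where "w = (\<lambda>i z u. l (?bs ! i) (act M (?bs ! i) z u))"
  have adjacent: "w k z u = w (Suc k) z u"
    if k: "Suc k < length ?bs" and z: "(z, zz_meet ?P I k) \<in> ?P" and u: "u \<in> vspace M z" for k z u
  proof -
    \<comment> \<open>Both evaluations factor through the meet, where \<open>l\<close> is a single
      functional.\<close>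
    have "w j z u = l (zz_meet ?P I k) (act M (zz_meet ?P I k) z u)"
      if j: "(zz_meet ?P I k, ?bs ! j) \<in> fst (zz ?P I)" for j
      using is_repD(4)[OF M z QP[OF j] u] lQ[OF j is_repD(2)[OF M z u]] by (simp add: w_def)
    then show ?thesis using zz(9,10)[OF k] by simp
  qed
  have chain: "w i z u = w j z u"
    if ij: "i \<le> j" "j < length ?bs" and z: "(z, ?bs ! i) \<in> ?P" "(z, ?bs ! j) \<in> ?P"
      and u: "u \<in> vspace M z" for i j z u
  proof -
    have "w i z u = w k z u" if "i \<le> k" "k \<le> j" for k
      using that
    proof (induction k rule: dec_induct)
      case (step k)
      then show ?case
        using adjacent[of k z u] zz_b_ge_between(2)[OF I ij z, of k] ij u by simp
    qed simp
    then show ?thesis using ij by simp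
  qed
  have indep: "w i z u = w j z u"
    if "i < length ?bs" "j < length ?bs" "(z, ?bs ! i) \<in> ?P" "(z, ?bs ! j) \<in> ?P" "u \<in> vspace M z"
    for i j z u
  proof (cases "i \<le> j")
    case True
    then show ?thesis by (rule chain[OF _ that(2-5)])
  next
    case False
    then show ?thesis by (intro chain[OF _ that(1,4,3,5), symmetric]) simp
  qed
  define idx where "idx = (\<lambda>z. SOME i. i < length ?bs \<and> (z, ?bs ! i) \<in> ?P)"
  have idx: "idx z < length ?bs" "(z, ?bs ! idx z) \<in> ?P" if z: "z \<in> I" for z
  proof -
    obtain b where "b \<in> sk ?P I" "(z, b) \<in> ?P" using sk_above[OF sub z] .
    then have "\<exists>i. i < length ?bs \<and> (z, ?bs ! i) \<in> ?P"
      using zz_lists(3)[OF sub] by (metis in_set_conv_nth)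
    from someI_ex[OF this] show "idx z < length ?bs" "(z, ?bs ! idx z) \<in> ?P"
      by (simp_all add: idx_def)
  qed
  have b0: "0 < length ?bs" using zz_lists_nonempty(2)[OF I] by simp
  show thesis
  proof (rule that)
    show "cosection_of s (Restr ?P I) M (\<lambda>z. w (idx z) z)"
      unfolding cosection_of_def Field_Restr_grid[OF sub]
    proof (intro conjI ballI allI impI)
      fix z assume z: "z \<in> I"
      show "linear_between s (*) (vspace M z) UNIV (w (idx z) z)"
        unfolding w_def
        by (rule linear_between_comp[OF is_repD(1)[OF M idx(2)[OF z]] lin[OF zz(6)[OF idx(1)[OF z]]]])
    next
      fix x y u assume "(x, y) \<in> Restr ?P I" and u: "u \<in> vspace M x"
      then have xy: "(x, y) \<in> ?P" and x: "x \<in> I" and y: "y \<in> I" by blast+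
      have "w (idx y) y (act M y x u) = w (idx y) x u"
        unfolding w_def is_repD(4)[OF M xy idx(2)[OF y] u] ..
      also have "\<dots> = w (idx x) x u"
        by (rule indep[OF idx(1)[OF y] idx(1)[OF x] grid_trans[OF xy idx(2)[OF y]] idx(2)[OF x] u])
      finally show "w (idx y) y (act M y x u) = w (idx x) x u" .
    qed
    fix u assume u: "u \<in> vspace M (?bs ! 0)"
    have bI: "?bs ! 0 \<in> I" by (rule subsetD[OF zz(4) zz(6)[OF b0]])
    have "w (idx (?bs ! 0)) (?bs ! 0) u = w 0 (?bs ! 0) u"
      by (rule indep[OF idx(1)[OF bI] b0 idx(2)[OF bI] grid_refl[OF subsetD[OF sub bI]] u])
    also have "\<dots> = l (?bs ! 0) u"
      unfolding w_def is_repD(3)[OF M subsetD[OF sub bI] u] ..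
    finally show "w (idx (?bs ! 0)) (?bs ! 0) u = l (?bs ! 0) u" .
  qed
qed

section \<open>Comparison of the two ranks\<close>

text \<open>For the nontrivial direction, sections and cosections are extended one by one.
  Connectedness of the interval allows their pairings to be computed at \<open>?b\<close>, where
  both extensions agree with the originals.\<close>

lemma dual_system_zz_iff_tot:
  assumes M: "is_rep s (grid p q) M" and I: "interval (grid p q) I"
  shows "dual_system s (fst (zz (grid p q) I)) M m \<longleftrightarrow> dual_system s (Restr (grid p q) I) M m"
proof
  let ?P = "grid p q" and ?Q = "fst (zz (grid p q) I)"
  let ?a = "zz_a (grid p q) I ! 0" and ?b = "zz_b (grid p q) I ! 0"
  note zz = zz_relations[OF I]
  show "dual_system s (Restr ?P I) M m \<Longrightarrow> dual_system s ?Q M m"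
    using dual_system_subset zz(1) by blast
  assume "dual_system s ?Q M m"
  then obtain v l where v: "\<And>i. i < m \<Longrightarrow> section_of ?Q M (v i)"
    and l: "\<And>i. i < m \<Longrightarrow> cosection_of s ?Q M (l i)"
    and lv: "\<And>i j x. i < m \<Longrightarrow> j < m \<Longrightarrow> x \<in> Field ?Q \<Longrightarrow> l i x (v j x) = (if i = j then 1 else 0)"
    unfolding dual_system_def by blast
  have "\<forall>i\<in>{..<m}. \<exists>v'. section_of (Restr ?P I) M v' \<and> v' ?a = v i ?a"
  proof
    fix i assume "i \<in> {..<m}"
    then have i: "i < m" by simp
    show "\<exists>v'. section_of (Restr ?P I) M v' \<and> v' ?a = v i ?a"
      by (rule section_zz_extends[OF M I v[OF i]]) (intro exI conjI)
  qed
  then obtain v' where v'_all: "\<forall>i\<in>{..<m}. section_of (Restr ?P I) M (v' i) \<and> v' i ?a = v i ?a"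
    unfolding bchoice_iff by (rule exE)
  have v': "section_of (Restr ?P I) M (v' i)" "v' i ?a = v i ?a" if "i < m" for i
    using v'_all[rule_format, of i] that by simp_all
  have "\<forall>i\<in>{..<m}. \<exists>l'. cosection_of s (Restr ?P I) M l' \<and> (\<forall>u\<in>vspace M ?b. l' ?b u = l i ?b u)"
  proof
    fix i assume "i \<in> {..<m}"
    then have i: "i < m" by simp
    show "\<exists>l'. cosection_of s (Restr ?P I) M l' \<and> (\<forall>u\<in>vspace M ?b. l' ?b u = l i ?b u)"
      by (rule cosection_zz_extends[OF M I l[OF i]]) (intro exI conjI ballI)
  qed
  then obtain l' where l'_all: "\<forall>i\<in>{..<m}. cosection_of s (Restr ?P I) M (l' i) \<and>
      (\<forall>u\<in>vspace M ?b. l' i ?b u = l i ?b u)"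
    unfolding bchoice_iff by (rule exE)
  have l': "cosection_of s (Restr ?P I) M (l' i)" "u \<in> vspace M ?b \<Longrightarrow> l' i ?b u = l i ?b u"
    if "i < m" for i u
    using l'_all[rule_format, of i] that by simp_all
  have conn: "connected_poset (Restr ?P I)" using I by (simp add: interval_def)
  note ab = zz(11)
  have bF: "?b \<in> Field (Restr ?P I)" by (rule FieldI2[OF subsetD[OF zz(1) ab]])
  have pairing: "l' i x (v' j x) = (if i = j then 1 else 0)"
    if ij: "i < m" "j < m" and x: "x \<in> Field (Restr ?P I)" for i j x
  proof -
    \<comment> \<open>The relation from \<open>?a\<close> to \<open>?b\<close> belongs to both
      posets. It carries the agreement of \<open>v'\<close> with \<open>v\<close> from the first
      minimal element to the first maximal one, where the cosections agree.\<close>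
    have "v' j ?b = act M ?b ?a (v' j ?a)"
      using section_ofD(2)[OF v'(1)[OF ij(2)], of ?a ?b] subsetD[OF zz(1) ab] by simp
    also have "\<dots> = v j ?b" using v'(2)[OF ij(2)] section_ofD(2)[OF v[OF ij(2)] ab] by simp
    finally have vb: "v' j ?b = v j ?b" .
    have "l' i x (v' j x) = l' i ?b (v' j ?b)"
      by (rule pairing_constant[OF conn v'(1)[OF ij(2)] l'(1)[OF ij(1)] x bF])
    also have "\<dots> = l i ?b (v j ?b)"
      unfolding vb using section_ofD(1)[OF v[OF ij(2)]] FieldD[OF ab] l'(2)[OF ij(1)] by blast
    finally show ?thesis using lv[OF ij] FieldD[OF ab] by simp
  qed
  show "dual_system s (Restr ?P I) M m"
    unfolding dual_system_def
    by (intro exI[of _ v'] exI[of _ l'] conjI allI impI ballI v'(1) l'(1) pairing)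
qed

theorem corollary6p13:
  fixes p q :: nat
    and s :: "'k::field \<Rightarrow> 'v::ab_group_add \<Rightarrow> 'v"
    and M :: "(nat \<times> nat, 'v) rep"
    and I :: "(nat \<times> nat) set"
  assumes "1 \<le> p" and "1 \<le> q"
    and "vector_space s"
    and "is_rep s (grid p q) M"
    and "interval (grid p q) I"
  shows "interval_rank s (tot (grid p q)) I M = interval_rank s (zz (grid p q)) I M"
proof -
  interpret vector_space s by fact
  note M = assms(4) and I = assms(5)
  let ?R = "Restr (grid p q) I" and ?Q = "fst (zz (grid p q) I)"
  note zz = zz_relations[OF I]
  have sub: "I \<subseteq> Field (grid p q)" and conn: "connected_poset ?R"
    using I by (simp_all add: interval_def)
  \<comment> \<open>Both compression maps are inclusions, so the pullback of \<open>M\<close> is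
    \<open>M\<close> itself read on a smaller relation. The pullback of the interval module is
    likewise unchanged.\<close>
  have "is_rep s ?R M" using is_rep_subset[OF M] by blast
  then have "interval_rank s (tot (grid p q)) I M = (GREATEST m. dual_system s ?R M m)"
    using multiplicity_in_interval_module[of ?R M I] conn finite_subset[OF sub finite_Field_grid]
    by (simp add: interval_rank_def tot_def pullback_rep_ident Field_Restr_grid[OF sub])
  also have "\<dots> = (GREATEST m. dual_system s ?Q M m)"
    by (simp only: dual_system_zz_iff_tot[OF M I])
  also have "\<dots> = interval_rank s (zz (grid p q)) I M"
  proof -
    have "is_rep s ?Q M" using is_rep_subset[OF M] zz(1) by blast
    from multiplicity_in_interval_module[OF this zz(2,3,4)] show ?thesis
      by (simp add: interval_rank_def zz_def pullback_rep_ident)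
  qed
  finally show ?thesis .
qed

end
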